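(* Suppose that $\Gamma$ is an additive subgroup of $\mathbb{R}$ with no minimal strictly positive element and $1 \in \Gamma$. Let $M = \{0\} \cup \{\gamma \in \Gamma \mid \gamma \geq 1\}$. Let $D = k[t;M]_{(t;M)}$ for some field $k$, let $K$ be the field of fractions of $D$, and let $v$ be the $M$-valuation on $K$. Suppose that $k$ is not algebraically closed or $\mathsf{gp}(M)$ is not divisible. Then for any nonzero, nonunit element $d \in D$, we have $$\mathcal{L}_{\operatorname{Int}^{\mathrm R}(K,D)}(d) = \begin{cases} \{2, 3, \dots, \lfloor v(d) \rfloor - 1, \lfloor v(d) \rfloor\}, & \text{if } v(d) \geq 2,\\ \{1\}, & \text{if } 1 \leq v(d) < 2, \end{cases}$$ and $$c_{\operatorname{Int}^{\mathrm R}(K,D)}(d) = \begin{cases} 0, & \text{if } 1 \leq v(d) < 2,\\ 2, & \text{if } 2 \leq v(d) < 3,\\ 3, & \text{if } v(d) \geq 3. \end{cases}$$ Moreover, for a nonzero, nonunit element $\varphi \in \operatorname{Int}^{\mathrm R}(K,D)$, we have $$\mathcal{L}_{\operatorname{Int}^{\mathrm R}(K,D)}(\varphi) = \begin{cases} \{2,3, \dots, \lfloor \alpha(\varphi)\rfloor\}, & \text{if } \alpha(\varphi) \geq 2,\\ \{1\}, & \text{if } 1 \leq \alpha(\varphi) < 2, \end{cases}$$ where $\alpha(\varphi) = \inf\{v(\varphi(a)) \mid a \in K\}$.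
   Context: For a domain $D$ with field of fractions $K$, $\operatorname{Int}^{\mathrm R}(K,D) = \{\varphi \in K(x) \mid \varphi(a) \in D \text{ for all } a \in K\}$; elements of $D$ are viewed in it as constant functions. Monoid ring: $k[t;M]$ consists of finite sums of terms $r t^\alpha$ ($r\in k$, $\alpha\in M$) with $t^{\alpha}t^{\beta}=t^{\alpha+\beta}$; $(t;M)$ is the ideal generated by $\{t^\alpha\mid \alpha\in M\setminus\{0\}\}$, and $k[t;M]_{(t;M)}$ is the localization at this prime ideal. $\mathsf{gp}(M)=\{\alpha-\alpha'\mid\alpha,\alpha'\in M\}$. The $M$-valuation $v$ is defined on $k[t;M]$ by sending $\sum_i a_i t^{\alpha_i}$, with distinct $\alpha_i \in M$ and nonzero $a_i \in k$, to $\min_i \alpha_i$; it extends uniquely to a valuation on $K$ with value group $\mathsf{gp}(M)$ (and $v(0)=\infty$). Factorizations: let $R$ be a domain and $\mathcal{A}(R)$ the set of atoms (irreducible elements) of $R$ up to association. For a nonzero nonunit $r\in R$, the set of factorizations is $\mathsf{Z}_R(r)=\{(e_{[a]})\in\bigoplus_{[a]\in\mathcal{A}(R)}\mathbb{N} \mid \prod a^{e_{[a]}}\sim r\}$, where $\sim$ denotes association and $0\in\mathbb{N}$. The length of $z=(e_{[a]})$ is $|z|=\sum e_{[a]}$, and $\mathcal{L}_R(r)=\{|z| \mid z\in\mathsf{Z}_R(r)\}$. For $z=(e_{[a]})$ and $z'=(e'_{[a]})$ in $\mathsf{Z}_R(r)$, put $\gcd(z,z')=(\min\{e_{[a]},e'_{[a]}\})$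 and $d(z,z')=\max\{|z-\gcd(z,z')|,|z'-\gcd(z,z')|\}$. For $N\in\mathbb{N}$, an $N$-chain between $z$ and $z'$ is a finite sequence $z=z_0,\dots,z_n=z'$ in $\mathsf{Z}_R(r)$ with $d(z_i,z_{i+1})\le N$ for all $i<n$. The catenary degree $c_R(r)$ is the minimal $N\in\mathbb{N}$ such that there is an $N$-chain between any two elements of $\mathsf{Z}_R(r)$. *)

theory Defs
  imports
    "HOL-Library.Poly_Mapping"
    "HOL-Library.Extended_Real"
    "HOL-Library.Multiset"
    "HOL-Computational_Algebra.Polynomial"
    "HOL-Computational_Algebra.Fraction_Field"
    "HOL-Algebra.Ring_Divisibility"
    "HOL-Algebra.Algebraic_Closure_Type"
begin

text \<open>
  Every ring below is given by a subset of an ambient type. The monoid rings \<open>k[t;M]\<close>, for \<open>M\<close> a set of reals, lie in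
  \<^typ>\<open>real \<Rightarrow>\<^sub>0 'k\<close>, which is \<open>k[t;\<real>]\<close> and an integral domain. Hence \<open>D\<close> and \<open>K\<close> are subsets of
  its field of fractions, and \<open>K(x)\<close> is a subset of the rational functions over that field.
\<close>

abbreviation ring_on :: "'a::ring_1 set \<Rightarrow> 'a ring" where
  "ring_on S \<equiv> ring_of_type_algebra \<lparr>carrier := S\<rparr>"

definition divisible_set :: "real set \<Rightarrow> bool" where
  "divisible_set G \<longleftrightarrow> (\<forall>n::nat. n > 0 \<longrightarrow> (\<forall>\<gamma>\<in>G. \<exists>\<delta>\<in>G. real n * \<delta> = \<gamma>))"

definition gp :: "real set \<Rightarrow> real set" where
  "gp M = {\<alpha> - \<alpha>' | \<alpha> \<alpha>'. \<alpha> \<in> M \<and> \<alpha>' \<in> M}"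


subsection \<open>The localized monoid ring and its valuation\<close>

definition monoid_ring :: "real set \<Rightarrow> (real \<Rightarrow>\<^sub>0 'k::field) set" where
  "monoid_ring M = {f. Poly_Mapping.keys f \<subseteq> M}"

definition monoid_ideal :: "real set \<Rightarrow> (real \<Rightarrow>\<^sub>0 'k::field) set" where
  "monoid_ideal M =
     genideal (ring_on (monoid_ring M)) {Poly_Mapping.single \<alpha> 1 | \<alpha>. \<alpha> \<in> M - {0}}"

definition localized_monoid_ring :: "real set \<Rightarrow> (real \<Rightarrow>\<^sub>0 'k::field) fract set" where
  "localized_monoid_ring M =
     {Fract f g | f g. f \<in> monoid_ring M \<and> g \<in> monoid_ring M \<and> g \<notin> monoid_ideal M}"

definition fraction_field_of :: "'a::field set \<Rightarrow> 'a set" where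
  "fraction_field_of D = {a / b | a b. a \<in> D \<and> b \<in> D \<and> b \<noteq> 0}"

definition min_exponent :: "(real \<Rightarrow>\<^sub>0 'k::field) \<Rightarrow> real" where
  "min_exponent f = Min (Poly_Mapping.keys f)"

text \<open>
  The valuation is defined on the whole field of fractions of \<open>k[t;\<real>]\<close>; on the field of fractions
  of \<open>k[t;M]\<close> it is the \<open>M\<close>-valuation. The lemma \<open>mval_Fract\<close> shows that the value does not
  depend on the fraction chosen.
\<close>

definition mval :: "(real \<Rightarrow>\<^sub>0 'k::field) fract \<Rightarrow> ereal" where
  "mval q = (if q = 0 then \<infinity> else
     ereal (THE r. \<exists>f g. f \<noteq> 0 \<and> g \<noteq> 0 \<and> q = Fract f g \<and> r = min_exponent f - min_exponent g))"

lemma min_exponent_mult: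
  fixes f g :: "real \<Rightarrow>\<^sub>0 'k::field"
  assumes "f \<noteq> 0" "g \<noteq> 0"
  shows "min_exponent (f * g) = min_exponent f + min_exponent g"
proof -
  define a b where "a = min_exponent f" and "b = min_exponent g"
  have a: "a \<in> Poly_Mapping.keys f" "\<And>x. x \<in> Poly_Mapping.keys f \<Longrightarrow> a \<le> x"
    using assms(1) unfolding a_def min_exponent_def by (auto intro: Min_in Min_le)
  have b: "b \<in> Poly_Mapping.keys g" "\<And>x. x \<in> Poly_Mapping.keys g \<Longrightarrow> b \<le> x"
    using assms(2) unfolding b_def min_exponent_def by (auto intro: Min_in Min_le)
  have "Poly_Mapping.lookup (f * g) (a + b) =
      (\<Sum>l. Poly_Mapping.lookup f l * (\<Sum>q. Poly_Mapping.lookup g q when a + b = l + q))"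
    by (rule lookup_mult)
  also have "\<dots> = (\<Sum>l. Poly_Mapping.lookup f l * Poly_Mapping.lookup g b when l = a)"
  proof (rule Sum_any.cong)
    fix l
    have "(\<Sum>q. Poly_Mapping.lookup g q when a + b = l + q)
        = (\<Sum>q. Poly_Mapping.lookup g q when q = a + b - l)"
      by (rule Sum_any.cong) (auto simp: when_def)
    then have inner: "(\<Sum>q. Poly_Mapping.lookup g q when a + b = l + q)
        = Poly_Mapping.lookup g (a + b - l)" by simp
    have "l = a" if "Poly_Mapping.lookup f l \<noteq> 0" "Poly_Mapping.lookup g (a + b - l) \<noteq> 0"
      using a(2)[of l] b(2)[of "a + b - l"] that by (auto simp: in_keys_iff)
    then show "Poly_Mapping.lookup f l * (\<Sum>q. Poly_Mapping.lookup g q when a + b = l + q)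
        = (Poly_Mapping.lookup f l * Poly_Mapping.lookup g b when l = a)"
      unfolding inner by (cases "l = a") auto
  qed
  also have "\<dots> = Poly_Mapping.lookup f a * Poly_Mapping.lookup g b"
    by simp
  finally have "Poly_Mapping.lookup (f * g) (a + b) = Poly_Mapping.lookup f a * Poly_Mapping.lookup g b" .
  then have "a + b \<in> Poly_Mapping.keys (f * g)"
    using a(1) b(1) by (auto simp: in_keys_iff)
  moreover have "a + b \<le> z" if z: "z \<in> Poly_Mapping.keys (f * g)" for z
  proof -
    obtain x y where "z = x + y" "x \<in> Poly_Mapping.keys f" "y \<in> Poly_Mapping.keys g"
      using keys_mult[of f g] z by blast
    then show ?thesis using a(2) b(2) by (simp add: add_mono)
  qed
  ultimately show ?thesis
    unfolding a_def[symmetric] b_def[symmetric] min_exponent_def[of "f * g"]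
    by (intro Min_eqI) auto
qed

lemma mval_Fract:
  fixes f g :: "real \<Rightarrow>\<^sub>0 'k::field"
  assumes "f \<noteq> 0" "g \<noteq> 0"
  shows "mval (Fract f g) = ereal (min_exponent f - min_exponent g)"
proof -
  have "(THE r. \<exists>f' g'. f' \<noteq> 0 \<and> g' \<noteq> 0 \<and> Fract f g = Fract f' g' \<and>
            r = min_exponent f' - min_exponent g') = min_exponent f - min_exponent g"
  proof (rule the_equality)
    fix r assume "\<exists>f' g'. f' \<noteq> 0 \<and> g' \<noteq> 0 \<and> Fract f g = Fract f' g' \<and>
            r = min_exponent f' - min_exponent g'"
    then obtain f' g' where *: "f' \<noteq> 0" "g' \<noteq> 0" "Fract f g = Fract f' g'"
      "r = min_exponent f' - min_exponent g'" by blast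
    then have "f * g' = f' * g" using assms by (simp add: eq_fract)
    then have "min_exponent f + min_exponent g' = min_exponent f' + min_exponent g"
      using min_exponent_mult * assms by metis
    then show "r = min_exponent f - min_exponent g" using * by simp
  qed (use assms in blast)
  moreover have "Fract f g \<noteq> 0"
    using assms by (simp add: Zero_fract_def eq_fract)
  ultimately show ?thesis by (simp add: mval_def)
qed


subsection \<open>Integer-valued rational functions\<close>

definition rational_functions :: "'a::field set \<Rightarrow> 'a poly fract set" where
  "rational_functions K = {Fract p q | p q. q \<noteq> 0 \<and>
     (\<forall>i. Polynomial.coeff p i \<in> K) \<and> (\<forall>i. Polynomial.coeff q i \<in> K)}"

definition rat_defined_at :: "'a::field poly fract \<Rightarrow> 'a \<Rightarrow> bool" where
  "rat_defined_at \<phi> a \<longleftrightarrow> (\<exists>p q. \<phi> = Fract p q \<and> poly q a \<noteq> 0)"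

definition rat_eval :: "'a::field poly fract \<Rightarrow> 'a \<Rightarrow> 'a" where
  "rat_eval \<phi> a = (THE y. \<exists>p q. \<phi> = Fract p q \<and> poly q a \<noteq> 0 \<and> y = poly p a / poly q a)"

lemma rat_eval_Fract:
  fixes p q :: "'a::field poly"
  assumes "poly q a \<noteq> 0"
  shows "rat_eval (Fract p q) a = poly p a / poly q a"
  unfolding rat_eval_def
proof (rule the_equality)
  fix y assume "\<exists>p' q'. Fract p q = Fract p' q' \<and> poly q' a \<noteq> 0 \<and> y = poly p' a / poly q' a"
  then obtain p' q' where *: "Fract p q = Fract p' q'" "poly q' a \<noteq> 0" "y = poly p' a / poly q' a"
    by blast
  have "q \<noteq> 0" "q' \<noteq> 0" using * assms by auto
  then have "p * q' = p' * q" using * by (simp add: eq_fract)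
  then have "poly p a * poly q' a = poly p' a * poly q a" by (metis poly_mult)
  then show "y = poly p a / poly q a"
    using *(2,3) assms by (simp add: frac_eq_eq)
qed (use assms in blast)

text \<open>As usual, \<open>\<phi>(a) \<in> D\<close> includes that \<open>\<phi>\<close> has no pole at \<open>a\<close>.\<close>

definition Int_R :: "'a::field set \<Rightarrow> 'a set \<Rightarrow> 'a poly fract set" where
  "Int_R K D = {\<phi> \<in> rational_functions K. \<forall>a\<in>K. rat_defined_at \<phi> a \<and> rat_eval \<phi> a \<in> D}"

definition const_fun :: "'a::field \<Rightarrow> 'a poly fract" where
  "const_fun d = Fract [:d:] 1"

definition min_val :: "(real \<Rightarrow>\<^sub>0 'k::field) fract set \<Rightarrow> (real \<Rightarrow>\<^sub>0 'k) fract poly fract \<Rightarrow> ereal"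
  where "min_val K \<phi> = (INF a\<in>K. mval (rat_eval \<phi> a))"


subsection \<open>Factorizations, lengths and catenary degree\<close>

text \<open>
  A factorization is a multiset of association classes of atoms; multiplicities are the
  exponents. \<^term>\<open>fmset R as\<close> is the multiset of the association classes of the members of the
  list \<open>as\<close>, and \<^term>\<open>wfactors R as r\<close> says that their product is associated to \<open>r\<close>.
\<close>

definition factorizations :: "'a ring \<Rightarrow> 'a \<Rightarrow> 'a set multiset set" where
  "factorizations R r = {fmset R as | as.
     set as \<subseteq> {a \<in> carrier R. ring_irreducible\<^bsub>R\<^esub> a} \<and> wfactors R as r}"

definition length_set :: "'a ring \<Rightarrow> 'a \<Rightarrow> nat set" where
  "length_set R r = size ` factorizations R r"

text \<open>The gcd of two factorizations is their multiset intersection.\<close>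

definition fact_dist :: "'b multiset \<Rightarrow> 'b multiset \<Rightarrow> nat" where
  "fact_dist z z' = max (size (z - z \<inter># z')) (size (z' - z \<inter># z'))"

definition chain_connected :: "'a ring \<Rightarrow> 'a \<Rightarrow> nat \<Rightarrow> 'a set multiset \<Rightarrow> 'a set multiset \<Rightarrow> bool" where
  "chain_connected R r N z z' \<longleftrightarrow> (\<exists>(n::nat) zs. zs 0 = z \<and> zs n = z' \<and>
     (\<forall>i\<le>n. zs i \<in> factorizations R r) \<and> (\<forall>i<n. fact_dist (zs i) (zs (Suc i)) \<le> N))"

text \<open>The infimum is in \<^typ>\<open>enat\<close>, so that the value is \<open>\<infinity>\<close> when no \<open>N\<close> works.\<close>

definition catenary_degree :: "'a ring \<Rightarrow> 'a \<Rightarrow> enat" where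
  "catenary_degree R r = Inf (enat ` {N. \<forall>z\<in>factorizations R r. \<forall>z'\<in>factorizations R r.
     chain_connected R r N z z'})"

end

theory Submission
  imports Defs
begin

text \<open>
  Write \<open>R\<close> for \<open>Int\<^sup>R(K, D)\<close>. A geometric series shows \<open>D = k + {x \<in> K. v(x) \<ge> 1}\<close>. For \<open>\<phi> \<in> R\<close> the value
  of \<open>\<phi>\<close> on a generic point of a sphere is a continuous function of the radius, and as \<open>\<Gamma>\<close> is dense it
  cannot jump from \<open>0\<close> to \<open>[1, \<infinity>)\<close>; hence \<open>v(\<phi>(a))\<close> is either \<open>0\<close> for all \<open>a\<close>, and \<open>\<phi>\<close> is a unit, or
  \<open>\<ge> 1\<close> for all \<open>a\<close>. So a product of \<open>n\<close> nonunits has \<open>\<alpha> \<ge> n\<close>. Conversely, the hypothesis on \<open>k\<close> or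
  \<open>gp(M)\<close> yields a polynomial \<open>P\<close> with \<open>v(P(y)) = min(n v(y), \<gamma>)\<close>, and with it rational functions with
  values in an interval \<open>[1, 1 + nc]\<close> that attain the upper end at a prescribed point. Dividing \<open>\<phi>\<close> with
  \<open>\<alpha>(\<phi>) \<ge> 2\<close> by such a function with \<open>\<alpha>(\<phi>) - 3 < nc \<le> \<alpha>(\<phi>) - 2\<close>, the upper end being attained where
  \<open>v(\<phi>)\<close> is nearly minimal, writes \<open>\<phi>\<close> as a product of two elements with \<open>1 \<le> \<alpha> < 2\<close>. Hence the atoms are
  the elements with \<open>1 \<le> \<alpha> < 2\<close>, splitting off constants of value \<open>1\<close> gives the lengths, and merging
  three atoms into two connects every factorization to one of length \<open>2\<close> by a \<open>3\<close>-chain. For the lower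
  bounds, two factorizations with a common atom, one of them of length \<open>2\<close>, are equal.
\<close>

subsection \<open>Factorizations controlled by a superadditive function\<close>

text \<open>Simplification may strip the carrier update from an operation first, hence the last two
  equations for the bare structure.\<close>

lemma ring_on_simps [simp]:
  "carrier (ring_on S) = S" "x \<otimes>\<^bsub>ring_on S\<^esub> y = x * y" "\<one>\<^bsub>ring_on S\<^esub> = 1"
  "x \<oplus>\<^bsub>ring_on S\<^esub> y = x + y" "\<zero>\<^bsub>ring_on S\<^esub> = 0"
  "x \<otimes>\<^bsub>ring_of_type_algebra\<^esub> y = x * y" "x \<oplus>\<^bsub>ring_of_type_algebra\<^esub> y = x + y"
  by (simp_all add: ring_of_type_algebra_def)

lemma foldr_ring_on: "foldr (\<otimes>\<^bsub>ring_on S\<^esub>) xs \<one>\<^bsub>ring_on S\<^esub> = prod_list xs"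
  by (induction xs) auto

lemma Units_ring_on_iff:
  fixes x :: "'a::field"
  shows "x \<in> Units (ring_on S) \<longleftrightarrow> x \<in> S \<and> x \<noteq> 0 \<and> inverse x \<in> S"
proof
  assume "x \<in> Units (ring_on S)"
  then obtain y where y: "x \<in> S" "y \<in> S" "x * y = 1" by (auto simp: Units_def)
  then have "y = inverse x" by (metis inverse_unique)
  then show "x \<in> S \<and> x \<noteq> 0 \<and> inverse x \<in> S" using y by auto
qed (auto simp: Units_def intro!: bexI[of _ "inverse x"])

section \<open>Distances and chains of factorizations\<close>

lemma fact_dist_le:
  fixes A B C :: "'b multiset"
  shows "fact_dist (A + C) (B + C) \<le> max (size A) (size B)"
proof -
  have le: "size (U + C - (U + C) \<inter># (V + C)) \<le> size U" for U V :: "'b multiset"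
  proof -
    \<comment> \<open>The common part \<open>C\<close> lies in the intersection, so cancelling the
      intersection leaves at most \<open>U\<close>.\<close>
    have "U + C - (U + C) \<inter># (V + C) \<subseteq># U"
      by (rule mset_subset_eqI) (auto simp: min_def)
    then show ?thesis by (rule size_mset_mono)
  qed
  show ?thesis
    using le[of A B] le[of B A] by (auto simp: fact_dist_def inf.commute)
qed

lemma fact_dist_le_size: "fact_dist z z' \<le> max (size z) (size z')"
  using fact_dist_le[of z "{#}" z'] by simp

text \<open>Disjoint factorizations have the largest possible distance, the maximum of their
  lengths. This is the source of all lower bounds for catenary degrees.\<close>

lemma fact_dist_less_imp_common:
  assumes "fact_dist z z' < max (size z) (size z')"
  shows "\<exists>x. x \<in># z \<and> x \<in># z'"
proof -
  have "z \<inter># z' \<noteq> {#}"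
  proof
    assume "z \<inter># z' = {#}"
    then have "fact_dist z z' = max (size z) (size z')" unfolding fact_dist_def by (simp only: diff_empty)
    then show False using assms by simp
  qed
  then obtain x where "x \<in># z \<inter># z'" by blast
  then show ?thesis by (intro exI[of _ x]) simp
qed

text \<open>Chains become a reflexive transitive closure, for which induction is available.
  Membership of \<open>z\<close> is stated separately because the closure is reflexive at every
  multiset.\<close>

lemma chain_connected_iff_rtranclp:
  "chain_connected R r N z z' \<longleftrightarrow> z \<in> factorizations R r \<and>
     (\<lambda>u w. u \<in> factorizations R r \<and> w \<in> factorizations R r \<and> fact_dist u w \<le> N)\<^sup>*\<^sup>* z z'"
  (is "_ \<longleftrightarrow> _ \<and> ?P\<^sup>*\<^sup>* z z'")
proof
  assume "chain_connected R r N z z'"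
  then obtain n zs where zs: "zs 0 = z" "zs n = z'"
    "\<forall>i\<le>n. zs i \<in> factorizations R r" "\<forall>i<n. fact_dist (zs i) (zs (Suc i)) \<le> N"
    by (auto simp: chain_connected_def)
  then have "(?P ^^ n) z z'" unfolding relpowp_fun_conv by (intro exI[of _ zs]) auto
  then show "z \<in> factorizations R r \<and> ?P\<^sup>*\<^sup>* z z'"
    using zs by (auto intro: relpowp_imp_rtranclp)
next
  assume z: "z \<in> factorizations R r \<and> ?P\<^sup>*\<^sup>* z z'"
  then obtain n where "(?P ^^ n) z z'" by (meson rtranclp_imp_relpowp)
  then obtain zs where zs: "zs 0 = z" "zs n = z'" "\<forall>i<n. ?P (zs i) (zs (Suc i))"
    unfolding relpowp_fun_conv by blast
  have "zs i \<in> factorizations R r" if "i \<le> n" for i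
    using zs z that by (cases i) auto
  then show "chain_connected R r N z z'"
    using zs unfolding chain_connected_def by blast
qed

lemma catenary_degree_eqI:
  assumes "\<And>z z'. z \<in> factorizations R r \<Longrightarrow> z' \<in> factorizations R r \<Longrightarrow> chain_connected R r N z z'"
    and "\<And>n. n < N \<Longrightarrow> \<exists>z\<in>factorizations R r. \<exists>z'\<in>factorizations R r. \<not> chain_connected R r n z z'"
  shows "catenary_degree R r = enat N"
  unfolding catenary_degree_def
proof (rule cInf_eq_minimum)
  fix x
  assume "x \<in> enat ` {N. \<forall>z\<in>factorizations R r. \<forall>z'\<in>factorizations R r. chain_connected R r N z z'}"
  then obtain n where "x = enat n"
      "\<forall>z\<in>factorizations R r. \<forall>z'\<in>factorizations R r. chain_connected R r n z z'" by blast
  then show "enat N \<le> x" using assms(2)[of n] by fastforce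
qed (use assms(1) in auto)

text \<open>
  \<open>\<alpha>\<close> plays the role of \<open>\<lambda>\<phi>. inf {v(\<phi>(a)) | a}\<close>, and \<open>T\<close> that of the constant atoms \<open>t(1 + t\<^sup>\<epsilon>)\<close>.
\<close>

locale valued_submonoid =
  fixes S :: "'a::field set" and \<alpha> :: "'a \<Rightarrow> real" and T :: "'a set"
  assumes one_closed: "1 \<in> S"
    and mult_closed: "x \<in> S \<Longrightarrow> y \<in> S \<Longrightarrow> x * y \<in> S"
    and value_unit: "x \<in> S \<Longrightarrow> x \<noteq> 0 \<Longrightarrow> inverse x \<in> S \<Longrightarrow> \<alpha> x = 0"
    and value_nonunit: "x \<in> S \<Longrightarrow> x \<noteq> 0 \<Longrightarrow> inverse x \<notin> S \<Longrightarrow> 1 \<le> \<alpha> x"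
    and value_mult: "x \<in> S \<Longrightarrow> y \<in> S \<Longrightarrow> x \<noteq> 0 \<Longrightarrow> y \<noteq> 0 \<Longrightarrow> \<alpha> x + \<alpha> y \<le> \<alpha> (x * y)"
    and split_value: "x \<in> S \<Longrightarrow> x \<noteq> 0 \<Longrightarrow> 2 \<le> \<alpha> x \<Longrightarrow>
        \<exists>y\<in>S. \<exists>z\<in>S. x = y * z \<and> 1 \<le> \<alpha> y \<and> \<alpha> y < 2 \<and> 1 \<le> \<alpha> z \<and> \<alpha> z < 2"
    and T_infinite: "infinite T"
    and T_closed: "t \<in> T \<Longrightarrow> t \<in> S \<and> t \<noteq> 0"
    and T_value: "t \<in> T \<Longrightarrow> \<alpha> t = 1"
    and T_distinct: "s \<in> T \<Longrightarrow> t \<in> T \<Longrightarrow> s \<noteq> t \<Longrightarrow> s / t \<notin> S"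
    and T_divides: "t \<in> T \<Longrightarrow> x \<in> S \<Longrightarrow> x \<noteq> 0 \<Longrightarrow> 2 \<le> \<alpha> x \<Longrightarrow> x / t \<in> S \<and> \<alpha> x - 1 \<le> \<alpha> (x / t)"
begin

section \<open>Divisibility and atoms\<close>

abbreviation "R \<equiv> ring_on S"

definition "Atoms = {x \<in> S. x \<noteq> 0 \<and> 1 \<le> \<alpha> x \<and> \<alpha> x < 2}"

lemma value_nonneg: "x \<in> S \<Longrightarrow> x \<noteq> 0 \<Longrightarrow> 0 \<le> \<alpha> x"
  using value_unit value_nonunit by fastforce

lemma divides_iff:
  assumes "x \<in> S" "x \<noteq> 0" shows "x divides\<^bsub>R\<^esub> y \<longleftrightarrow> y / x \<in> S"
  using assms by (auto simp: factor_def intro!: bexI[of _ "y / x"])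

lemma value_divides:
  assumes "x \<in> S" "x \<noteq> 0" "y \<noteq> 0" "y / x \<in> S" shows "\<alpha> x \<le> \<alpha> y"
  using value_mult[of x "y / x"] value_nonneg[of "y / x"] assms by simp

lemma associated_iff:
  assumes "x \<in> S" "x \<noteq> 0" "y \<in> S" "y \<noteq> 0"
  shows "x \<sim>\<^bsub>R\<^esub> y \<longleftrightarrow> x / y \<in> S \<and> y / x \<in> S"
  using assms by (auto simp: associated_def divides_iff)

lemma associated_value:
  assumes "x \<in> S" "x \<noteq> 0" "y \<in> S" "y \<noteq> 0" "x \<sim>\<^bsub>R\<^esub> y"
  shows "\<alpha> x = \<alpha> y"
  using assms value_divides[of x y] value_divides[of y x] by (force simp: associated_iff)

text \<open>An element of value at least 2 splits into two nonunits by \<open>split_value\<close>.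
  Conversely, two nonunit factors have value at least 1 each, so by superadditivity their product
  has value at least 2.\<close>

lemma ring_irreducible_iff:
  assumes "x \<in> S" shows "ring_irreducible\<^bsub>R\<^esub> x \<longleftrightarrow> x \<in> Atoms"
proof
  assume irr: "ring_irreducible\<^bsub>R\<^esub> x"
  then have x: "x \<noteq> 0" "inverse x \<notin> S"
    using assms Units_ring_on_iff[of x S] by (auto simp: ring_irreducible_def Divisibility.irreducible_def)
  have "\<alpha> x < 2"
  proof (rule ccontr)
    assume "\<not> \<alpha> x < 2"
    then obtain y z where yz: "y \<in> S" "z \<in> S" "x = y * z" "1 \<le> \<alpha> y" "\<alpha> y < 2"
      using split_value[of x] assms x by auto
    have "y \<noteq> 0" "z \<noteq> 0" using x yz by auto
    \<comment> \<open>The value of \<open>y\<close> is smaller than that of \<open>x\<close>, so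
      \<open>y\<close> is a proper factor. Irreducibility would make it a unit, of value 0, but its
      value is at least 1.\<close>
    then have "\<not> x divides\<^bsub>R\<^esub> y"
      using value_divides[of x y] yz x assms \<open>\<not> \<alpha> x < 2\<close> by (auto simp: divides_iff)
    then have "properfactor R y x"
      using yz by (auto simp: properfactor_def factor_def)
    then have "y \<in> Units R"
      using irr yz by (auto simp: ring_irreducible_def Divisibility.irreducible_def)
    then show False using value_unit yz by (auto simp: Units_ring_on_iff)
  qed
  then show "x \<in> Atoms" using x assms value_nonunit by (auto simp: Atoms_def)
next
  assume x: "x \<in> Atoms"
  then have x': "x \<in> S" "x \<noteq> 0" "1 \<le> \<alpha> x" "\<alpha> x < 2" by (auto simp: Atoms_def)
  have "b \<in> Units R" if b: "b \<in> S" "properfactor R b x" for b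
  proof (rule ccontr)
    assume bu: "b \<notin> Units R"
    obtain c where c: "c \<in> S" "x = b * c" "\<not> x divides\<^bsub>R\<^esub> b"
      using b by (auto simp: properfactor_def factor_def)
    have nz: "b \<noteq> 0" "c \<noteq> 0" using c x' by auto
    have "inverse c \<notin> S" using c x' nz by (auto simp: divides_iff field_simps)
    then have "1 \<le> \<alpha> c" "1 \<le> \<alpha> b"
      using value_nonunit nz c b bu by (auto simp: Units_ring_on_iff)
    then show False using value_mult[of b c] b c nz x' by simp
  qed
  then show "ring_irreducible\<^bsub>R\<^esub> x"
    using x' value_unit by (auto simp: ring_irreducible_def Divisibility.irreducible_def Units_ring_on_iff)
qed

text \<open>Superadditivity bounds the number of atoms by the value of their product, which later
  limits all lengths.\<close>

lemma prod_list_Atoms: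
  assumes "set as \<subseteq> Atoms"
  shows "prod_list as \<in> S" "prod_list as \<noteq> 0" "real (length as) \<le> \<alpha> (prod_list as)"
proof -
  have "prod_list as \<in> S \<and> prod_list as \<noteq> 0 \<and> real (length as) \<le> \<alpha> (prod_list as)"
    using assms
  proof (induction as)
    case Nil
    then show ?case using one_closed value_nonneg[of 1] by simp
  next
    case (Cons a as)
    then show ?case using value_mult[of a "prod_list as"] mult_closed by (auto simp: Atoms_def)
  qed
  then show "prod_list as \<in> S" "prod_list as \<noteq> 0" "real (length as) \<le> \<alpha> (prod_list as)" by auto
qed

text \<open>For lists of atoms the irreducibility part of \<open>wfactors\<close> is automatic, so
  only the association of the product with \<open>r\<close> remains to be tracked.\<close>

lemma factorizations_eq:
  "factorizations R r = {fmset R as | as. set as \<subseteq> Atoms \<and> prod_list as \<sim>\<^bsub>R\<^esub> r}"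
proof -
  have "set as \<subseteq> {a \<in> carrier R. ring_irreducible\<^bsub>R\<^esub> a} \<and> wfactors R as r \<longleftrightarrow>
      set as \<subseteq> Atoms \<and> prod_list as \<sim>\<^bsub>R\<^esub> r" for as
  proof -
    have "set as \<subseteq> {a \<in> carrier R. ring_irreducible\<^bsub>R\<^esub> a} \<longleftrightarrow> set as \<subseteq> Atoms"
      using ring_irreducible_iff by (auto simp: Atoms_def)
    moreover have "wfactors R as r \<longleftrightarrow> prod_list as \<sim>\<^bsub>R\<^esub> r" if "set as \<subseteq> Atoms"
      using that ring_irreducible_iff unfolding wfactors_def foldr_ring_on
      by (fastforce simp: ring_irreducible_def Atoms_def)
    ultimately show ?thesis by auto
  qed
  then show ?thesis unfolding factorizations_def by presburger
qed

lemma size_fmset [simp]: "size (fmset R as) = length as"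
  by (simp add: fmset_def)

lemma associated_refl: "x \<in> S \<Longrightarrow> x \<noteq> 0 \<Longrightarrow> x \<sim>\<^bsub>R\<^esub> x"
  using one_closed by (simp add: associated_iff)

lemma associated_sym: "x \<sim>\<^bsub>R\<^esub> y \<Longrightarrow> y \<sim>\<^bsub>R\<^esub> x"
  by (auto simp: associated_def)

lemma divides_trans: "x divides\<^bsub>R\<^esub> y \<Longrightarrow> y divides\<^bsub>R\<^esub> z \<Longrightarrow> x divides\<^bsub>R\<^esub> z"
  by (auto simp: factor_def mult.assoc intro: mult_closed)

lemma associated_trans: "x \<sim>\<^bsub>R\<^esub> y \<Longrightarrow> y \<sim>\<^bsub>R\<^esub> z \<Longrightarrow> x \<sim>\<^bsub>R\<^esub> z"
  unfolding associated_def using divides_trans by blast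

lemma assocs_eq_iff:
  assumes "x \<in> S" "x \<noteq> 0" "y \<in> S" "y \<noteq> 0"
  shows "assocs R x = assocs R y \<longleftrightarrow> x \<sim>\<^bsub>R\<^esub> y"
proof -
  have mem: "z \<in> assocs R w \<longleftrightarrow> z \<in> S \<and> z \<sim>\<^bsub>R\<^esub> w" for z w
    by (simp add: eq_closure_of_def elem_def)
  show ?thesis
  proof
    assume "assocs R x = assocs R y"
    then show "x \<sim>\<^bsub>R\<^esub> y" using assms mem associated_refl by blast
  next
    assume "x \<sim>\<^bsub>R\<^esub> y"
    then show "assocs R x = assocs R y"
      using mem associated_sym associated_trans by blast
  qed
qed

section \<open>Lengths of factorizations\<close>

context
  fixes r assumes r: "r \<in> S" "r \<noteq> 0" "1 \<le> \<alpha> r"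
begin

lemma prod_list_value: "set as \<subseteq> Atoms \<Longrightarrow> prod_list as \<sim>\<^bsub>R\<^esub> r \<Longrightarrow> \<alpha> (prod_list as) = \<alpha> r"
  using prod_list_Atoms r associated_value by blast

lemma length_pos: "set as \<subseteq> Atoms \<Longrightarrow> prod_list as \<sim>\<^bsub>R\<^esub> r \<Longrightarrow> length as \<noteq> 0"
  using prod_list_value[of as] value_unit[of 1] one_closed r by auto

text \<open>Association preserves the value. A single atom has value below 2, and a value below 2
  leaves room for at most one atom.\<close>

lemma length_one_iff:
  assumes "set as \<subseteq> Atoms" "prod_list as \<sim>\<^bsub>R\<^esub> r" shows "length as = 1 \<longleftrightarrow> \<alpha> r < 2"
proof
  assume "length as = 1"
  then obtain a where "as = [a]" by (metis One_nat_def length_0_conv length_Suc_conv)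
  then show "\<alpha> r < 2" using assms prod_list_value[of as] by (auto simp: Atoms_def)
next
  assume "\<alpha> r < 2"
  then have "real (length as) < 2" using assms prod_list_Atoms prod_list_value by fastforce
  moreover have "length as \<noteq> 0" using length_pos[OF assms] .
  ultimately show "length as = 1" by linarith
qed

lemma length_ge_2:
  assumes "set as \<subseteq> Atoms" "prod_list as \<sim>\<^bsub>R\<^esub> r" "2 \<le> \<alpha> r" shows "2 \<le> length as"
proof -
  have "length as \<noteq> 0" "length as \<noteq> 1" using length_pos length_one_iff assms by auto
  then show ?thesis by linarith
qed

end

text \<open>Induction from \<open>n = 2\<close>, which is \<open>split_value\<close>. In the step a
  constant from \<open>T\<close> is split off; it is an atom and costs at most 1 in value, so the
  quotient still has value at least \<open>n\<close>.\<close>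

lemma atom_list_exists:
  assumes "2 \<le> n" "r \<in> S" "r \<noteq> 0" "real n \<le> \<alpha> r"
  shows "\<exists>as. set as \<subseteq> Atoms \<and> prod_list as = r \<and> length as = n"
  using assms
proof (induction n arbitrary: r rule: dec_induct)
  case base
  then obtain y z where yz: "y \<in> S" "z \<in> S" "r = y * z" "1 \<le> \<alpha> y" "\<alpha> y < 2" "1 \<le> \<alpha> z" "\<alpha> z < 2"
    using split_value by fastforce
  then show ?case using base by (intro exI[of _ "[y, z]"]) (auto simp: Atoms_def)
next
  case (step n)
  obtain t where t: "t \<in> T" using T_infinite by (metis ex_in_conv finite.emptyI)
  have "r / t \<in> S" "real n \<le> \<alpha> (r / t)" using T_divides[OF t, of r] step by auto
  then obtain as where "set as \<subseteq> Atoms" "prod_list as = r / t" "length as = n"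
    using step T_closed[OF t] by (metis divide_eq_0_iff)
  then show ?case using T_closed[OF t] T_value[OF t]
    by (intro exI[of _ "t # as"]) (auto simp: Atoms_def)
qed

lemma length_set_ge_2:
  assumes "r \<in> S" "r \<noteq> 0" "2 \<le> \<alpha> r"
  shows "length_set R r = {2..nat \<lfloor>\<alpha> r\<rfloor>}"
proof (intro equalityI subsetI)
  fix n assume "n \<in> length_set R r"
  then obtain as where as: "set as \<subseteq> Atoms" "prod_list as \<sim>\<^bsub>R\<^esub> r" "n = length as"
    by (auto simp: length_set_def factorizations_eq)
  then have "real n \<le> \<alpha> r" using prod_list_Atoms prod_list_value assms by force
  moreover have "2 \<le> n" using as length_ge_2 assms by simp
  ultimately show "n \<in> {2..nat \<lfloor>\<alpha> r\<rfloor>}" by (simp add: le_nat_floor)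
next
  fix n assume n: "n \<in> {2..nat \<lfloor>\<alpha> r\<rfloor>}"
  then have "2 \<le> n" "real n \<le> \<alpha> r" using assms by (auto simp: le_nat_iff le_floor_iff)
  then obtain as where "set as \<subseteq> Atoms" "prod_list as = r" "length as = n"
    using atom_list_exists assms by blast
  then show "n \<in> length_set R r"
    using associated_refl assms unfolding length_set_def factorizations_eq
    by (intro image_eqI[of _ _ "fmset R as"]) auto
qed

lemma factorizations_atom:
  assumes "r \<in> S" "r \<noteq> 0" "1 \<le> \<alpha> r" "\<alpha> r < 2"
  shows "factorizations R r = {{#assocs R r#}}"
proof (intro equalityI subsetI)
  fix z assume "z \<in> factorizations R r"
  then obtain as where as: "set as \<subseteq> Atoms" "prod_list as \<sim>\<^bsub>R\<^esub> r" "z = fmset R as"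
    by (auto simp: factorizations_eq)
  then have "length as = 1" using length_one_iff assms by blast
  then obtain a where "as = [a]" by (metis One_nat_def length_0_conv length_Suc_conv)
  then show "z \<in> {{#assocs R r#}}"
    using as assms assocs_eq_iff[of a r] by (auto simp: fmset_def Atoms_def)
next
  fix z assume "z \<in> {{#assocs R r#}}"
  then show "z \<in> factorizations R r"
    using assms associated_refl unfolding factorizations_eq
    by (intro CollectI exI[of _ "[r]"]) (auto simp: fmset_def Atoms_def)
qed

lemma length_set_atom:
  assumes "r \<in> S" "r \<noteq> 0" "1 \<le> \<alpha> r" "\<alpha> r < 2"
  shows "length_set R r = {1}"
  using factorizations_atom[OF assms] by (simp add: length_set_def)

section \<open>Catenary degrees\<close>

lemma catenary_degree_atom:
  assumes "r \<in> S" "r \<noteq> 0" "1 \<le> \<alpha> r" "\<alpha> r < 2"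
  shows "catenary_degree R r = 0"
proof -
  have "catenary_degree R r = enat 0"
    by (rule catenary_degree_eqI)
      (auto simp: factorizations_atom[OF assms] chain_connected_iff_rtranclp)
  then show ?thesis by (simp add: zero_enat_def)
qed

text \<open>Cancelling the common atom shows that the remaining part of \<open>z'\<close> is
  associated to the other atom of \<open>z\<close>. That has value below 2, so by
  \<open>length_one_iff\<close> the remaining part is one atom, in the same class.\<close>

lemma pair_common_class:
  assumes r: "r \<in> S" "r \<noteq> 0"
    and z: "z \<in> factorizations R r" "size z = 2"
    and z': "z' \<in> factorizations R r"
    and common: "x \<in># z" "x \<in># z'"
  shows "z' = z"
proof -
  obtain as where as: "set as \<subseteq> Atoms" "prod_list as \<sim>\<^bsub>R\<^esub> r" "z = fmset R as"
    using z by (auto simp: factorizations_eq)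
  obtain bs where bs: "set bs \<subseteq> Atoms" "prod_list bs \<sim>\<^bsub>R\<^esub> r" "z' = fmset R bs"
    using z' by (auto simp: factorizations_eq)
  obtain a where a: "a \<in> set as" "x = assocs R a"
    using common(1) as by (auto simp: fmset_def)
  obtain b where b: "b \<in> set bs" "x = assocs R b"
    using common(2) bs by (auto simp: fmset_def)
  have "length as = 2" using z as by simp
  then have "length (remove1 a as) = 1" using a by (simp add: length_remove1)
  then obtain c where c: "remove1 a as = [c]" by (metis One_nat_def length_0_conv length_Suc_conv)
  have as': "mset as = {#a, c#}"
    using a c mset_remove1[of a as] insert_DiffM[of a "mset as"] by simp
  define cs where "cs = remove1 b bs"
  have bs': "mset bs = add_mset b (mset cs)" using b unfolding cs_def by simp
  have pa: "prod_list as = a * c" "prod_list bs = b * prod_list cs"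
    using as' bs' prod_mset_prod_list[of as] prod_mset_prod_list[of bs] prod_mset_prod_list[of cs] by auto
  have cs: "set cs \<subseteq> Atoms" using bs set_remove1_subset unfolding cs_def by fast
  have cA: "c \<in> Atoms" "a \<in> Atoms" "b \<in> Atoms"
    using as a b bs set_remove1_subset[of a as] c by auto
  then have nz: "a \<in> S" "b \<in> S" "c \<in> S" "a \<noteq> 0" "b \<noteq> 0" "c \<noteq> 0" by (auto simp: Atoms_def)
  note pcs = prod_list_Atoms[OF cs]
  have ab: "a / b \<in> S" "b / a \<in> S" using a b nz assocs_eq_iff associated_iff by blast+
  have "a * c \<sim>\<^bsub>R\<^esub> b * prod_list cs"
    using as(2) bs(2) pa associated_sym associated_trans by metis
  then have q: "a * c / (b * prod_list cs) \<in> S" "b * prod_list cs / (a * c) \<in> S"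
    using nz pcs mult_closed associated_iff[of "a * c" "b * prod_list cs"] by auto
  \<comment> \<open>The atoms \<open>a\<close> and \<open>b\<close> agree only up to association;
    multiplying by \<open>b / a\<close> or \<open>a / b\<close> removes them from the
    quotients.\<close>
  have "c / prod_list cs \<in> S" "prod_list cs / c \<in> S"
    using mult_closed[OF q(1) ab(2)] mult_closed[OF q(2) ab(1)] nz by simp_all
  then have "prod_list cs \<sim>\<^bsub>R\<^esub> c" using nz pcs by (simp add: associated_iff)
  moreover from this have "length cs = 1"
    using length_one_iff[of c cs] cs cA by (auto simp: Atoms_def)
  then obtain d where d: "cs = [d]" by (metis One_nat_def length_0_conv length_Suc_conv)
  ultimately have "assocs R d = assocs R c" using assocs_eq_iff nz pcs by simp
  then show "z' = z" using as(3) bs(3) as' bs' a b d by (simp add: fmset_def)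
qed

text \<open>A chain can never leave \<open>z\<close>: a step to \<open>w\<close> of distance below
  \<open>max 2 (size w)\<close> forces a common atom, and then \<open>pair_common_class\<close>
  gives \<open>w = z\<close>.\<close>

lemma pair_not_connected:
  assumes r: "r \<in> S" "r \<noteq> 0"
    and z: "z \<in> factorizations R r" "size z = 2"
    and N: "\<And>w. w \<in> factorizations R r \<Longrightarrow> w \<noteq> z \<Longrightarrow> N < max 2 (size w)"
    and z': "z' \<noteq> z"
  shows "\<not> chain_connected R r N z z'"
proof
  assume "chain_connected R r N z z'"
  then have "(\<lambda>u w. u \<in> factorizations R r \<and> w \<in> factorizations R r \<and> fact_dist u w \<le> N)\<^sup>*\<^sup>* z z'"
    by (auto simp: chain_connected_iff_rtranclp)
  then have "z' = z"
  proof (induction rule: rtranclp_induct)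
    case (step y w)
    show ?case
    proof (rule ccontr)
      assume "w \<noteq> z"
      then have "fact_dist z w < max (size z) (size w)" using N[of w] step z by force
      then show False
        using fact_dist_less_imp_common pair_common_class[OF r z] step \<open>w \<noteq> z\<close> by blast
    qed
  qed simp
  then show False using z' by simp
qed

text \<open>Three atoms have a product of value at least 3, which \<open>split_value\<close>
  rewrites as a product of two atoms. This is a step of distance at most 3 that shortens the list.
  Bounding the distance in both orders makes the relation symmetric, so that
  \<open>three_chain_exists\<close> can reverse such a chain.\<close>

lemma connected_to_pair:
  assumes "2 \<le> \<alpha> r" "r \<in> S" "r \<noteq> 0" "set as \<subseteq> Atoms" "prod_list as \<sim>\<^bsub>R\<^esub> r"
  shows "\<exists>w. w \<in> factorizations R r \<and> size w = 2 \<and>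
    (\<lambda>u w. u \<in> factorizations R r \<and> w \<in> factorizations R r \<and> fact_dist u w \<le> 3 \<and> fact_dist w u \<le> 3)\<^sup>*\<^sup>* (fmset R as) w"
  (is "\<exists>w. _ \<and> _ \<and> ?P\<^sup>*\<^sup>* _ w")
  using assms(4,5)
proof (induction "length as" arbitrary: as rule: less_induct)
  case less
  have F: "fmset R as \<in> factorizations R r" using less by (auto simp: factorizations_eq)
  show ?case
  proof (cases "length as \<le> 2")
    case True
    then have "length as = 2"
      using length_ge_2[of r as] assms less by simp
    then show ?thesis using F by (intro exI[of _ "fmset R as"]) auto
  next
    case False
    then obtain a b c ds where as: "as = a # b # c # ds"
      by (metis One_nat_def Suc_1 Suc_le_mono le0 length_Cons list.exhaust list.size(3))
    have abc: "a * (b * c) \<in> S" "a * (b * c) \<noteq> 0" "3 \<le> \<alpha> (a * (b * c))"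
      using prod_list_Atoms[of "[a, b, c]"] less as by auto
    then obtain y z where yz: "y \<in> S" "z \<in> S" "a * (b * c) = y * z" "1 \<le> \<alpha> y" "\<alpha> y < 2" "1 \<le> \<alpha> z" "\<alpha> z < 2"
      using split_value[of "a * (b * c)"] by auto
    define bs where "bs = y # z # ds"
    have "prod_list as = a * (b * c) * prod_list ds" by (simp add: as mult_ac)
    then have "prod_list bs = prod_list as" by (simp add: bs_def yz(3) mult_ac)
    then have "prod_list bs \<sim>\<^bsub>R\<^esub> r" using less.prems(2) by simp
    moreover have "y \<noteq> 0" "z \<noteq> 0" using abc yz(3) by auto
    ultimately have bs: "set bs \<subseteq> Atoms" "prod_list bs \<sim>\<^bsub>R\<^esub> r" "length bs < length as"
      using less.prems(1) yz by (auto simp: bs_def as Atoms_def simp del: prod_list.Cons)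
    have "fmset R as = {#assocs R a, assocs R b, assocs R c#} + fmset R ds"
      "fmset R bs = {#assocs R y, assocs R z#} + fmset R ds"
      by (simp_all add: fmset_def bs_def as)
    then have "fact_dist (fmset R as) (fmset R bs) \<le> 3" "fact_dist (fmset R bs) (fmset R as) \<le> 3"
      using fact_dist_le[of "{#assocs R a, assocs R b, assocs R c#}" "fmset R ds" "{#assocs R y, assocs R z#}"]
        fact_dist_le[of "{#assocs R y, assocs R z#}" "fmset R ds" "{#assocs R a, assocs R b, assocs R c#}"] by simp_all
    moreover have "fmset R bs \<in> factorizations R r" using bs by (auto simp: factorizations_eq)
    ultimately have "?P (fmset R as) (fmset R bs)" using F by simp
    moreover obtain w where "w \<in> factorizations R r" "size w = 2" "?P\<^sup>*\<^sup>* (fmset R bs) w"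
      using less.hyps[OF bs(3) bs(1,2)] by blast
    ultimately show ?thesis
      using converse_rtranclp_into_rtranclp[of ?P "fmset R as" "fmset R bs" w] by blast
  qed
qed

lemma three_chain_exists:
  assumes r: "2 \<le> \<alpha> r" "r \<in> S" "r \<noteq> 0"
    and z: "z \<in> factorizations R r" "z' \<in> factorizations R r"
  shows "chain_connected R r 3 z z'"
proof -
  let ?P = "\<lambda>u w. u \<in> factorizations R r \<and> w \<in> factorizations R r \<and> fact_dist u w \<le> 3 \<and> fact_dist w u \<le> 3"
  have pair: "\<exists>w. w \<in> factorizations R r \<and> size w = 2 \<and> ?P\<^sup>*\<^sup>* u w" if u: "u \<in> factorizations R r" for u
  proof -
    obtain as where "set as \<subseteq> Atoms" "prod_list as \<sim>\<^bsub>R\<^esub> r" "u = fmset R as"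
      using u unfolding factorizations_eq by blast
    then show ?thesis using connected_to_pair[OF r, of as] by simp
  qed
  obtain w where w: "w \<in> factorizations R r" "size w = 2" "?P\<^sup>*\<^sup>* z w"
    using pair[OF z(1)] by blast
  obtain w' where w': "w' \<in> factorizations R r" "size w' = 2" "?P\<^sup>*\<^sup>* z' w'"
    using pair[OF z(2)] by blast
  have "symp ?P" by (auto simp: symp_def)
  then have "?P\<^sup>*\<^sup>* w' z'" using sympD[OF symp_rtranclp w'(3)] by blast
  \<comment> \<open>Two factorizations of length 2 are at distance at most 2, so the two chains can
    be joined directly.\<close>
  moreover have "?P w w'" using w w' fact_dist_le_size[of w w'] fact_dist_le_size[of w' w] by auto
  ultimately have "?P\<^sup>*\<^sup>* z z'"
    using rtranclp_trans[OF rtranclp.rtrancl_into_rtrancl[OF w(3)]] by blast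
  then have "(\<lambda>u w. u \<in> factorizations R r \<and> w \<in> factorizations R r \<and> fact_dist u w \<le> 3)\<^sup>*\<^sup>* z z'"
    by (rule rtranclp_mono[THEN predicate2D, rotated]) auto
  then show ?thesis using z by (simp add: chain_connected_iff_rtranclp)
qed

text \<open>Lengths 2 and 3 both occur. With steps below 3, a chain that starts at length 2 keeps
  this length: a step to a longer factorization would share an atom with a pair, contradicting
  \<open>pair_common_class\<close>.\<close>

lemma catenary_degree_ge_3:
  assumes r: "r \<in> S" "r \<noteq> 0" "3 \<le> \<alpha> r"
  shows "catenary_degree R r = 3"
proof -
  have "{2, 3} \<subseteq> length_set R r"
    using length_set_ge_2[of r] assms by (auto simp: le_nat_iff le_floor_iff)
  then obtain z z' where z: "z \<in> factorizations R r" "size z = 2" "z' \<in> factorizations R r" "size z' = 3"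
    by (auto simp: length_set_def)
  show ?thesis
  proof (subst catenary_degree_eqI[of R r 3])
    fix n :: nat assume n: "n < 3"
    have "\<not> chain_connected R r n z z'"
    proof
      assume "chain_connected R r n z z'"
      then have "(\<lambda>u w. u \<in> factorizations R r \<and> w \<in> factorizations R r \<and> fact_dist u w \<le> n)\<^sup>*\<^sup>* z z'"
        by (auto simp: chain_connected_iff_rtranclp)
      then have "size z' = 2"
      proof (induction rule: rtranclp_induct)
        case (step y w)
        show ?case
        proof (rule ccontr)
          assume w: "size w \<noteq> 2"
          obtain bs where bs: "set bs \<subseteq> Atoms" "prod_list bs \<sim>\<^bsub>R\<^esub> r" "w = fmset R bs"
            using step by (auto simp: factorizations_eq)
          have "2 < size w" using w length_ge_2[of r bs] r bs by simp
          then have "fact_dist y w < max (size y) (size w)" using n step by linarith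
          then have "w = y"
            using fact_dist_less_imp_common pair_common_class[OF r(1,2), of y] step by metis
          then show False using w step by simp
        qed
      qed (use z in simp)
      then show False using z by simp
    qed
    then show "\<exists>z\<in>factorizations R r. \<exists>z'\<in>factorizations R r. \<not> chain_connected R r n z z'"
      using z by blast
  qed (use three_chain_exists r in \<open>auto simp: numeral_eq_enat\<close>)
qed

text \<open>All lengths are 2, which bounds every distance by 2. For the lower bound it remains to
  find two different factorizations, of the form \<open>t * (r / t)\<close> with \<open>t\<close> in
  \<open>T\<close>.\<close>

lemma catenary_degree_2:
  assumes r: "r \<in> S" "r \<noteq> 0" "2 \<le> \<alpha> r" "\<alpha> r < 3"
  shows "catenary_degree R r = 2"
proof -
  have "length_set R r = {2}"
  proof -
    have "\<lfloor>\<alpha> r\<rfloor> = 2" using r by (simp add: floor_eq_iff)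
    then show ?thesis using length_set_ge_2[of r] r by simp
  qed
  then have size: "size z = 2" if "z \<in> factorizations R r" for z
    using that by (auto simp: length_set_def)
  let ?z = "\<lambda>t. fmset R [t, r / t]"
  have fz: "?z t \<in> factorizations R r" if t: "t \<in> T" for t
  proof -
    note * = T_divides[OF t, of r] T_closed[OF t] T_value[OF t]
    have "\<alpha> (r / t) < 2" using value_mult[of t "r / t"] * r by simp
    then have "set [t, r / t] \<subseteq> Atoms" using * r by (auto simp: Atoms_def)
    moreover have "prod_list [t, r / t] \<sim>\<^bsub>R\<^esub> r" using * r associated_refl by simp
    ultimately show ?thesis by (auto simp: factorizations_eq)
  qed
  \<comment> \<open>Two constants would not suffice, since \<open>r / t1\<close> may be associated
    to \<open>t2\<close>. It cannot be associated to both \<open>t2\<close> and \<open>t3\<close>,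
    which are not associated to each other.\<close>
  obtain U where "U \<subseteq> T" "card U = 3" using T_infinite by (metis infinite_arbitrarily_large)
  then obtain t1 t2 t3 where t: "t1 \<in> T" "t2 \<in> T" "t3 \<in> T" "t1 \<noteq> t2" "t1 \<noteq> t3" "t2 \<noteq> t3"
    by (auto simp: card_3_iff)
  have cls: "assocs R s \<noteq> assocs R t" if "s \<in> T" "t \<in> T" "s \<noteq> t" for s t
    using T_distinct[OF that] T_closed[OF that(1)] T_closed[OF that(2)]
      assocs_eq_iff[of s t] associated_iff[of s t] by blast
  have "?z t1 \<noteq> ?z t2 \<or> ?z t1 \<noteq> ?z t3"
    using cls[of t1 t2] cls[of t1 t3] cls[of t2 t3] t
    by (auto simp: fmset_def add_eq_conv_ex)
  then obtain z z' where z: "z \<in> factorizations R r" "z' \<in> factorizations R r" "z' \<noteq> z"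
    using fz t by metis
  show ?thesis
  proof (subst catenary_degree_eqI[of R r 2])
    fix u w assume uw: "u \<in> factorizations R r" "w \<in> factorizations R r"
    have "fact_dist u w \<le> 2" using fact_dist_le_size[of u w] size uw by simp
    then show "chain_connected R r 2 u w"
      using uw unfolding chain_connected_iff_rtranclp by (intro conjI r_into_rtranclp) auto
  next
    fix n :: nat assume "n < 2"
    then show "\<exists>z\<in>factorizations R r. \<exists>z'\<in>factorizations R r. \<not> chain_connected R r n z z'"
      using pair_not_connected[of r z n z'] size z r by fastforce
  qed (simp add: numeral_eq_enat)
qed

end

subsection \<open>The valuation\<close>

lemma min_exponent_le: "a \<in> Poly_Mapping.keys f \<Longrightarrow> min_exponent f \<le> a"
  unfolding min_exponent_def by (rule Min_le) auto

lemma min_exponent_in_keys: "f \<noteq> 0 \<Longrightarrow> min_exponent f \<in> Poly_Mapping.keys f"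
  unfolding min_exponent_def by (rule Min_in) auto

lemma min_exponent_single [simp]: "c \<noteq> 0 \<Longrightarrow> min_exponent (Poly_Mapping.single a c) = a"
  by (simp add: min_exponent_def)

lemma single_eq_0_iff [simp]: "Poly_Mapping.single a c = 0 \<longleftrightarrow> c = 0"
  by (metis single_zero inj_single injD)

lemma min_exponent_one [simp]: "min_exponent 1 = 0"
  by (simp add: min_exponent_def)

lemma min_exponent_add_ge:
  assumes "f + g \<noteq> 0" "f \<noteq> 0" "g \<noteq> 0"
  shows "min (min_exponent f) (min_exponent g) \<le> min_exponent (f + g)"
  using min_exponent_in_keys[OF assms(1)] keys_add[of f g] min_exponent_le
  by (metis UnE min.coboundedI1 min.coboundedI2 subsetD)

lemma Fract_eq_0_iff: "g \<noteq> 0 \<Longrightarrow> Fract f g = 0 \<longleftrightarrow> f = 0"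
  by (simp add: Zero_fract_def eq_fract)

lemma mval_0 [simp]: "mval 0 = \<infinity>"
  by (simp add: mval_def)

lemma mval_cases:
  fixes x :: "(real \<Rightarrow>\<^sub>0 'k::field) fract"
  assumes "x \<noteq> 0"
  obtains f g where "f \<noteq> 0" "g \<noteq> 0" "x = Fract f g" "mval x = ereal (min_exponent f - min_exponent g)"
  using assms mval_Fract by (cases x rule: Fract_cases_nonzero) blast+

lemma mval_finite:
  assumes "x \<noteq> 0" obtains r where "mval x = ereal r"
  using assms by (metis mval_cases)

lemma mval_eq_PInf_iff [simp]: "mval x = \<infinity> \<longleftrightarrow> x = 0"
  by (metis mval_0 mval_finite PInfty_neq_ereal(1))

lemma mval_neq_MInf [simp]: "mval x \<noteq> - \<infinity>"
  by (metis mval_0 mval_finite MInfty_neq_ereal(1) MInfty_neq_PInfty(1))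

lemma mval_ereal_nonzero: "mval x = ereal r \<Longrightarrow> x \<noteq> 0"
  by auto

lemma mval_mult: "mval (x * y) = mval x + mval y"
proof (cases "x = 0 \<or> y = 0")
  case False
  then obtain f g f' g' where "f \<noteq> 0" "g \<noteq> 0" "x = Fract f g" "f' \<noteq> 0" "g' \<noteq> 0" "y = Fract f' g'"
    by (metis mval_cases)
  then show ?thesis by (simp add: mval_Fract min_exponent_mult)
qed auto

lemma mval_one [simp]: "mval 1 = 0"
  using mval_Fract[of 1 1] by (simp add: One_fract_def zero_ereal_def)

lemma mval_inverse: "x \<noteq> 0 \<Longrightarrow> mval (inverse x) = - mval x"
  by (elim mval_cases) (simp add: mval_Fract)

lemma mval_divide: "y \<noteq> 0 \<Longrightarrow> mval (x / y) = mval x - mval y"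
  by (simp add: divide_inverse mval_mult mval_inverse minus_ereal_def)

lemma mval_power: "mval x = ereal r \<Longrightarrow> mval (x ^ n) = ereal (real n * r)"
  by (induction n) (simp_all add: mval_mult zero_ereal_def algebra_simps)

lemma mval_uminus [simp]:
  fixes x :: "(real \<Rightarrow>\<^sub>0 'k::field) fract"
  shows "mval (- x) = mval x"
proof -
  have "mval (- 1 :: (real \<Rightarrow>\<^sub>0 'k::field) fract) = 0"
  proof -
    obtain r where r: "mval (- 1 :: (real \<Rightarrow>\<^sub>0 'k::field) fract) = ereal r" by (rule mval_finite[of "- 1"]) auto
    have "mval ((- 1) * (- 1) :: (real \<Rightarrow>\<^sub>0 'k::field) fract) = ereal (r + r)"
      by (simp only: mval_mult r plus_ereal.simps)
    then show ?thesis using r by (simp add: zero_ereal_def)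
  qed
  then show ?thesis using mval_mult[of "- 1" x] by simp
qed

lemma mval_add_ge: "min (mval x) (mval y) \<le> mval (x + y)"
proof (cases "x = 0 \<or> y = 0 \<or> x + y = 0")
  case False
  then obtain f g f' g' where *: "f \<noteq> 0" "g \<noteq> 0" "x = Fract f g" "f' \<noteq> 0" "g' \<noteq> 0" "y = Fract f' g'"
    by (metis mval_cases)
  then have s: "x + y = Fract (f * g' + f' * g) (g * g')" by (simp add: mult.commute)
  then have "f * g' + f' * g \<noteq> 0" using False * by (auto simp: Fract_eq_0_iff)
  then show ?thesis
    using min_exponent_add_ge[of "f * g'" "f' * g"] *
    by (simp add: s mval_Fract min_exponent_mult min_def split: if_splits)
qed (auto simp: min_def)

lemma mval_diff_ge: "min (mval x) (mval y) \<le> mval (x - y)"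
  using mval_add_ge[of x "- y"] by simp

lemma mval_add_eq:
  assumes "mval x < mval y" shows "mval (x + y) = mval x"
proof (rule antisym)
  have "min (mval (x + y)) (mval y) \<le> mval x"
    using mval_diff_ge[of "x + y" y] by simp
  then show "mval (x + y) \<le> mval x" using assms by (auto simp: min_def split: if_splits)
qed (use mval_add_ge[of x y] assms in \<open>simp add: min_def less_imp_le\<close>)

lemma mval_add_neq:
  assumes "mval x \<noteq> mval y" shows "mval (x + y) = min (mval x) (mval y)"
  using mval_add_eq[of x y] mval_add_eq[of y x] assms
  by (cases "mval x < mval y") (auto simp: add.commute min_def)

section \<open>Monomials and generic values of polynomials\<close>

definition tpow :: "real \<Rightarrow> (real \<Rightarrow>\<^sub>0 'k::field) fract" where
  "tpow a = Fract (Poly_Mapping.single a 1) 1"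

lemma mval_tpow [simp]: "mval (tpow a) = ereal a"
  by (simp add: tpow_def mval_Fract)

lemma tpow_nonzero [simp]: "tpow a \<noteq> 0"
  using mval_tpow[of a] by (metis mval_ereal_nonzero)

text \<open>
  The piecewise linear function \<open>N(\<gamma>) = min\<^sub>i (v(p\<^sub>i) + i\<gamma>)\<close>; \<open>E\<close> contains its break points, where
  cancellation may occur.
\<close>

lemma mval_poly_generic:
  fixes p :: "(real \<Rightarrow>\<^sub>0 'k::field) fract poly"
  assumes "p \<noteq> 0"
  shows "\<exists>N E. continuous_on UNIV N \<and> mono N \<and> finite E \<and>
    ((\<lambda>g. ereal (N g)) \<longlongrightarrow> mval (poly p 0)) at_top \<and>
    (\<forall>y g. mval y = ereal g \<longrightarrow> g \<notin> E \<longrightarrow> mval (poly p y) = ereal (N g))"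
  using assms
proof (induction p)
  case (pCons c p)
  show ?case
  proof (cases "p = 0")
    case True
    then have "c \<noteq> 0" using pCons by auto
    then obtain v where "mval c = ereal v" by (rule mval_finite)
    then show ?thesis using True
      by (intro exI[of _ "\<lambda>_. v"] exI[of _ "{}"]) (auto simp: mono_def)
  next
    case False
    then obtain N E where N: "continuous_on UNIV N" "mono N" "finite E"
      and eq: "\<And>y g. mval y = ereal g \<Longrightarrow> g \<notin> E \<Longrightarrow> mval (poly p y) = ereal (N g)"
      using pCons.IH by blast
    \<comment> \<open>\<open>G\<close> is the generic value of \<open>y * poly p y\<close>. The
      summand \<open>g\<close> turns the monotone \<open>N\<close> into a strictly increasing
      function.\<close>
    define G where "G g = g + N g" for g
    have G: "continuous_on UNIV G" "strict_mono G"
      using N(1) monoD[OF N(2)] unfolding G_def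
      by (auto intro!: continuous_intros simp: strict_mono_def add_less_le_mono less_imp_le)
    have Gtop: "filterlim G at_top at_top"
    proof (rule filterlim_at_top_mono)
      show "filterlim (\<lambda>g. N 0 + g) at_top at_top"
        by (rule filterlim_tendsto_add_at_top[OF tendsto_const filterlim_ident])
      show "\<forall>\<^sub>F g in at_top. N 0 + g \<le> G g"
        using eventually_ge_at_top[of 0] by eventually_elim (simp add: G_def monoD[OF N(2)])
    qed
    have eqG: "mval (y * poly p y) = ereal (G g)" if "mval y = ereal g" "g \<notin> E" for y g
      using eq[OF that] that by (simp add: mval_mult G_def)
    show ?thesis
    proof (cases "c = 0")
      case True
      have "((\<lambda>g. ereal (G g)) \<longlongrightarrow> \<infinity>) at_top"
        using Gtop by (auto simp: tendsto_PInfty filterlim_at_top_dense)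
      then show ?thesis using True G N(3) eqG
        by (intro exI[of _ G] exI[of _ E]) (auto simp: strict_mono_mono)
    next
      case False
      then obtain v where v: "mval c = ereal v" by (rule mval_finite)
      \<comment> \<open>A tie between \<open>c\<close> and \<open>y * poly p y\<close> is the only
        new place for cancellation; as \<open>G\<close> is strictly increasing, there is at most
        one.\<close>
      define E' where "E' = E \<union> {g. G g = v}"
      have "finite {g. G g = v}"
      proof (cases "{g. G g = v} = {}")
        case False
        then obtain g where "G g = v" by blast
        then have "{g. G g = v} = {g}" using strict_mono_eq[OF G(2)] by auto
        then show ?thesis by simp
      qed simp
      then have "finite E'" using N(3) by (simp add: E'_def)
      \<comment> \<open>For large \<open>g\<close> the constant term wins, and \<open>c\<close> is
        the value of the polynomial at 0.\<close>
      moreover have "\<forall>\<^sub>F g in at_top. v \<le> G g" using Gtop by (auto simp: filterlim_at_top)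
      then have "\<forall>\<^sub>F g in at_top. ereal (min v (G g)) = mval c"
        by eventually_elim (simp add: v)
      then have "((\<lambda>g. ereal (min v (G g))) \<longlongrightarrow> mval c) at_top"
        by (rule tendsto_eventually)
      moreover have "mval (c + y * poly p y) = ereal (min v (G g))"
        if "mval y = ereal g" "g \<notin> E'" for y g
        using mval_add_neq[of c "y * poly p y"] eqG[of y g] that v by (auto simp: E'_def min_def)
      moreover have "mono (\<lambda>g. min v (G g))"
        using strict_mono_mono[OF G(2)] by (auto simp: mono_def min_def intro: order_trans)
      ultimately show ?thesis using G(1)
        by (intro exI[of _ "\<lambda>g. min v (G g)"] exI[of _ E']) (auto intro!: continuous_intros)
    qed
  qed
qed simp

section \<open>Residues and polynomials without roots\<close>

definition const_fract :: "'k::field \<Rightarrow> (real \<Rightarrow>\<^sub>0 'k) fract" where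
  "const_fract c = Fract (Poly_Mapping.single 0 c) 1"

lemma const_fract_hom:
  "const_fract 0 = 0" "const_fract (a + b) = const_fract a + const_fract b"
  "const_fract (a * b) = const_fract a * const_fract b"
  by (simp_all add: const_fract_def Zero_fract_def single_add mult_single)

lemma mval_const_fract: "c \<noteq> 0 \<Longrightarrow> mval (const_fract c) = 0"
  by (simp add: const_fract_def mval_Fract zero_ereal_def)

text \<open>The residue field of the valuation is \<open>k\<close>. At value 0 the residue is the
  quotient of the lowest coefficients of numerator and denominator: subtracting this multiple of the
  denominator cancels the lowest term.\<close>

lemma mval_residue:
  fixes a :: "(real \<Rightarrow>\<^sub>0 'k::field) fract"
  assumes "0 \<le> mval a"
  shows "\<exists>c. 0 < mval (a - const_fract c)"
proof (cases "0 < mval a")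
  case True
  then show ?thesis by (intro exI[of _ 0]) (simp add: const_fract_hom)
next
  case False
  then have va: "mval a = 0" using assms by simp
  then have "a \<noteq> 0" by auto
  then obtain f g where fg: "f \<noteq> 0" "g \<noteq> 0" "a = Fract f g" "mval a = ereal (min_exponent f - min_exponent g)"
    by (rule mval_cases)
  define m where "m = min_exponent g"
  define c where "c = Poly_Mapping.lookup f m / Poly_Mapping.lookup g m"
  define h where "h = f - Poly_Mapping.single 0 c * g"
  have mf: "min_exponent f = m" using fg va by (simp add: m_def zero_ereal_def)
  have sg: "Poly_Mapping.lookup (Poly_Mapping.single 0 c * g) b = c * Poly_Mapping.lookup g b" for b
    by (subst mult_map_scale_conv_mult[symmetric]) (simp add: Poly_Mapping.map.rep_eq when_def)
  have lm: "Poly_Mapping.lookup g m \<noteq> 0"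
    using min_exponent_in_keys[OF fg(2)] by (simp add: m_def in_keys_iff)
  have keys: "m < b" if "b \<in> Poly_Mapping.keys h" for b
  proof -
    have "Poly_Mapping.lookup f m = c * Poly_Mapping.lookup g m" using lm by (simp add: c_def)
    then have "b \<noteq> m" using that by (auto simp: in_keys_iff h_def lookup_minus sg)
    moreover have "b \<in> Poly_Mapping.keys f \<or> b \<in> Poly_Mapping.keys g"
      using that by (auto simp: in_keys_iff h_def lookup_minus sg)
    then have "m \<le> b" using min_exponent_le[of b f] min_exponent_le[of b g] mf m_def by auto
    ultimately show ?thesis by simp
  qed
  have "a - const_fract c = Fract h g"
    using fg by (simp add: const_fract_def h_def)
  moreover have "0 < mval (Fract h g)"
  proof (cases "h = 0")
    case False
    then show ?thesis using keys[OF min_exponent_in_keys] fg by (simp add: mval_Fract m_def)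
  qed (use fg in \<open>simp add: Fract_eq_0_iff[THEN iffD2]\<close>)
  ultimately show ?thesis by metis
qed

lemma mval_poly_nonneg:
  assumes "\<And>i. 0 \<le> mval (coeff p i)" "0 \<le> mval y"
  shows "0 \<le> mval (poly p y)"
  using assms(1)
proof (induction p)
  case (pCons c p)
  have "0 \<le> mval c" "0 \<le> mval (poly p y)"
    using pCons.prems[of 0] pCons.IH pCons.prems[of "Suc _"] by auto
  then have "0 \<le> mval (y * poly p y)" using assms(2) by (simp add: mval_mult)
  then show ?case using \<open>0 \<le> mval c\<close> mval_add_ge[of c "y * poly p y"]
    by (auto simp: min_def split: if_splits)
qed simp

text \<open>Congruent points give congruent polynomial values. The induction uses
  \<open>y p(y) - z p(z) = (y - z) p(y) + z (p(y) - p(z))\<close>.\<close>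

lemma mval_poly_diff_pos:
  assumes "\<And>i. 0 \<le> mval (coeff p i)" "0 < mval (y - z)" "0 \<le> mval y" "0 \<le> mval z"
  shows "0 < mval (poly p y - poly p z)"
  using assms(1)
proof (induction p)
  case (pCons c p)
  have nn: "0 \<le> mval (coeff p i)" for i using pCons.prems[of "Suc i"] by simp
  have "0 < mval (z * (poly p y - poly p z))"
    using pCons.IH[OF nn] assms(4) by (simp add: mval_mult add_nonneg_pos)
  moreover have "0 < mval ((y - z) * poly p y)"
    using mval_poly_nonneg[OF nn assms(3)] assms(2) by (simp add: mval_mult add_pos_nonneg)
  ultimately have "0 < mval ((y - z) * poly p y + z * (poly p y - poly p z))"
    using mval_add_ge[of "(y - z) * poly p y" "z * (poly p y - poly p z)"]
    by (meson less_le_trans min_less_iff_conj)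
  then show ?case by (simp add: algebra_simps)
qed simp

lemma poly_map_const_fract: "poly (map_poly const_fract p) (const_fract c) = const_fract (poly p c)"
  by (induction p) (auto simp: map_poly_pCons const_fract_hom)

text \<open>At a point of negative value the leading term strictly dominates the others.\<close>

lemma mval_poly_large:
  assumes "\<And>i. 0 \<le> mval (coeff p i)" "mval (lead_coeff p) = 0" "mval y = ereal g" "g < 0"
  shows "mval (poly p y) = ereal (real (degree p) * g)"
  using assms(1,2)
proof (induction p)
  case (pCons c p)
  show ?case
  proof (cases "p = 0")
    case True
    then show ?thesis using pCons by (simp add: zero_ereal_def)
  next
    case False
    then have *: "mval (poly p y) = ereal (real (degree p) * g)"
      using pCons.IH pCons.prems(1)[of "Suc _"] pCons.prems(2) by simp
    then have y: "mval (y * poly p y) = ereal (real (degree (pCons c p)) * g)"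
      using assms(3) False by (simp add: mval_mult algebra_simps)
    have "real (degree (pCons c p)) * g < 0"
      using False assms(4) by (simp add: mult_pos_neg)
    then have "mval (y * poly p y) < mval c"
      using pCons.prems(1)[of 0] unfolding y by (cases "mval c") (auto simp: zero_ereal_def)
    then have "mval (y * poly p y + c) = mval (y * poly p y)" by (rule mval_add_eq)
    then show ?thesis using y by (simp add: add.commute)
  qed
qed simp

text \<open>If \<open>y\<close> has nonnegative value and residue \<open>c\<close>, then the
  polynomial at \<open>y\<close> is congruent to \<open>poly p c\<close>, which is nonzero and hence
  of value 0. If \<open>y\<close> has negative value, the leading term decides.\<close>

lemma rootless_poly_mval:
  fixes p :: "'k::field poly"
  assumes "degree p > 0" "\<And>x. poly p x \<noteq> 0"
  shows "mval (poly (map_poly const_fract p) y) = min (ereal (real (degree p)) * mval y) 0"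
proof -
  have inj: "const_fract a = 0 \<longleftrightarrow> a = 0" for a :: 'k
    using mval_const_fract[of a] const_fract_hom(1) by (cases "a = 0") auto
  let ?P = "map_poly const_fract p"
  have deg: "degree ?P = degree p" by (rule degree_map_poly) (simp add: inj)
  have coeff: "coeff ?P i = const_fract (coeff p i)" for i
    by (simp add: coeff_map_poly const_fract_hom)
  have nn: "0 \<le> mval (coeff ?P i)" for i
    using mval_const_fract[of "coeff p i"] by (cases "coeff p i = 0") (auto simp: coeff const_fract_hom)
  have lead: "mval (lead_coeff ?P) = 0" using assms(1) by (auto simp: deg coeff intro!: mval_const_fract)
  show ?thesis
  proof (cases "0 \<le> mval y")
    case True
    then obtain c where c: "0 < mval (y - const_fract c)"
      using mval_residue by blast
    have "0 \<le> mval (const_fract c)"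
      using mval_const_fract[of c] by (cases "c = 0") (auto simp: const_fract_hom)
    then have "0 < mval (poly ?P y - poly ?P (const_fract c))"
      using mval_poly_diff_pos[OF nn c True] by simp
    moreover have "mval (poly ?P (const_fract c)) = 0"
      unfolding poly_map_const_fract by (rule mval_const_fract) (rule assms(2))
    ultimately have "mval (poly ?P y) = 0"
      using mval_add_eq[of "poly ?P (const_fract c)" "poly ?P y - poly ?P (const_fract c)"] by simp
    moreover have "0 \<le> ereal (real (degree p)) * mval y" using True by simp
    ultimately show ?thesis by (simp add: min_def)
  next
    case False
    then obtain g where g: "mval y = ereal g" "g < 0"
      by (cases "mval y") (auto simp: zero_ereal_def)
    have "real (degree p) * g < 0" using assms(1) g by (simp add: mult_pos_neg)
    then show ?thesis using mval_poly_large[OF nn lead g] g deg by (simp add: min_def zero_ereal_def)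
  qed
qed

subsection \<open>Monoid rings and rational functions\<close>

lemma keys_subset_mult:
  assumes "Poly_Mapping.keys f \<subseteq> A" "Poly_Mapping.keys g \<subseteq> B"
    and "\<And>a b. a \<in> A \<Longrightarrow> b \<in> B \<Longrightarrow> a + b \<in> C"
  shows "Poly_Mapping.keys (f * g) \<subseteq> C"
  using keys_mult[of f g] assms by blast

lemma keys_subset_add:
  "Poly_Mapping.keys f \<subseteq> A \<Longrightarrow> Poly_Mapping.keys g \<subseteq> A \<Longrightarrow> Poly_Mapping.keys (f + g) \<subseteq> A"
  using keys_add[of f g] by blast

lemma keys_uminus_eq: "Poly_Mapping.keys (- f) = Poly_Mapping.keys (f :: 'a \<Rightarrow>\<^sub>0 'b::ab_group_add)"
  by (auto simp: in_keys_iff)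

lemma keys_subset_diff:
  fixes f g :: "'a \<Rightarrow>\<^sub>0 'b::ab_group_add"
  shows "Poly_Mapping.keys f \<subseteq> A \<Longrightarrow> Poly_Mapping.keys g \<subseteq> A \<Longrightarrow> Poly_Mapping.keys (f - g) \<subseteq> A"
  using keys_subset_add[of f A "- g"] by (simp add: keys_uminus_eq)

lemma keys_subset_sum:
  "(\<And>i. i \<in> I \<Longrightarrow> Poly_Mapping.keys (f i) \<subseteq> A) \<Longrightarrow> Poly_Mapping.keys (sum f I) \<subseteq> A"
  by (induction I rule: infinite_finite_induct) (simp_all add: keys_subset_add)

lemma poly_mapping_eq_sum_single:
  "f = (\<Sum>a\<in>Poly_Mapping.keys f. Poly_Mapping.single a (Poly_Mapping.lookup f a))"
  by (rule poly_mapping_eqI) (simp add: lookup_sum lookup_single when_def in_keys_iff)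

text \<open>Among nonnegative exponents only \<open>0 + 0\<close> gives 0, so the constant
  coefficient is multiplicative.\<close>

lemma lookup_mult_0:
  fixes f g :: "real \<Rightarrow>\<^sub>0 'k::field"
  assumes "Poly_Mapping.keys f \<subseteq> {0..}" "Poly_Mapping.keys g \<subseteq> {0..}"
  shows "Poly_Mapping.lookup (f * g) 0 = Poly_Mapping.lookup f 0 * Poly_Mapping.lookup g 0"
proof -
  have "Poly_Mapping.lookup (f * g) 0 =
      (\<Sum>l. Poly_Mapping.lookup f l * (\<Sum>q. Poly_Mapping.lookup g q when 0 = l + q))"
    by (rule lookup_mult)
  also have "\<dots> = (\<Sum>l. Poly_Mapping.lookup f l * Poly_Mapping.lookup g 0 when l = 0)"
  proof (rule Sum_any.cong)
    fix l
    have "(\<Sum>q. Poly_Mapping.lookup g q when 0 = l + q) = (\<Sum>q. Poly_Mapping.lookup g q when q = - l)"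
      by (rule Sum_any.cong) (auto simp: when_def)
    then have inner: "(\<Sum>q. Poly_Mapping.lookup g q when 0 = l + q) = Poly_Mapping.lookup g (- l)" by simp
    have "l = 0" if "Poly_Mapping.lookup f l \<noteq> 0" "Poly_Mapping.lookup g (- l) \<noteq> 0"
    proof -
      have "l \<in> {0..}" "- l \<in> {0..}" using assms that unfolding in_keys_iff[symmetric] by blast+
      then show ?thesis by simp
    qed
    then show "Poly_Mapping.lookup f l * (\<Sum>q. Poly_Mapping.lookup g q when 0 = l + q)
        = (Poly_Mapping.lookup f l * Poly_Mapping.lookup g 0 when l = 0)"
      unfolding inner by (cases "l = 0") auto
  qed
  also have "\<dots> = Poly_Mapping.lookup f 0 * Poly_Mapping.lookup g 0"
    by simp
  finally show ?thesis .
qed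

lemma a_inv_ring_of_type_algebra: "\<ominus>\<^bsub>ring_of_type_algebra\<^esub> x = - (x :: 'a::comm_ring_1)"
proof -
  interpret ring "ring_of_type_algebra :: 'a ring" by (rule ring_from_type_algebra)
  show ?thesis by (rule minus_equality) (auto simp: ring_of_type_algebra_def)
qed

lemma ring_ring_on:
  fixes S :: "'a::comm_ring_1 set"
  assumes "1 \<in> S" "\<And>x. x \<in> S \<Longrightarrow> - x \<in> S"
    "\<And>x y. x \<in> S \<Longrightarrow> y \<in> S \<Longrightarrow> x * y \<in> S" "\<And>x y. x \<in> S \<Longrightarrow> y \<in> S \<Longrightarrow> x + y \<in> S"
  shows "ring (ring_on S)"
proof -
  interpret ring "ring_of_type_algebra :: 'a ring" by (rule ring_from_type_algebra)
  have "subring S ring_of_type_algebra"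
    using assms by (intro subringI) (auto simp: a_inv_ring_of_type_algebra, auto simp: ring_of_type_algebra_def)
  then show ?thesis by (rule subring_is_ring)
qed

section \<open>Evaluation of rational functions\<close>

lemma rat_eval_mult:
  assumes "rat_defined_at \<phi> a" "rat_defined_at \<psi> a"
  shows "rat_defined_at (\<phi> * \<psi>) a" "rat_eval (\<phi> * \<psi>) a = rat_eval \<phi> a * rat_eval \<psi> a"
proof -
  obtain p q p' q' where *: "\<phi> = Fract p q" "poly q a \<noteq> 0" "\<psi> = Fract p' q'" "poly q' a \<noteq> 0"
    using assms unfolding rat_defined_at_def by blast
  then have "\<phi> * \<psi> = Fract (p * p') (q * q')" "poly (q * q') a \<noteq> 0" by simp_all
  then show "rat_defined_at (\<phi> * \<psi>) a" "rat_eval (\<phi> * \<psi>) a = rat_eval \<phi> a * rat_eval \<psi> a"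
    using * unfolding rat_defined_at_def by (blast, simp add: rat_eval_Fract)
qed

lemma rat_eval_inverse:
  assumes "rat_defined_at \<phi> a" "rat_eval \<phi> a \<noteq> 0"
  shows "rat_defined_at (inverse \<phi>) a" "rat_eval (inverse \<phi>) a = inverse (rat_eval \<phi> a)"
proof -
  obtain p q where *: "\<phi> = Fract p q" "poly q a \<noteq> 0"
    using assms unfolding rat_defined_at_def by blast
  then have "inverse \<phi> = Fract q p" "poly p a \<noteq> 0" using assms(2) by (auto simp: rat_eval_Fract)
  then show "rat_defined_at (inverse \<phi>) a" "rat_eval (inverse \<phi>) a = inverse (rat_eval \<phi> a)"
    using * unfolding rat_defined_at_def by (blast, simp add: rat_eval_Fract)
qed

lemma rat_eval_const_fun: "rat_defined_at (const_fun d) a" "rat_eval (const_fun d) a = d"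
proof -
  have "poly 1 a \<noteq> 0" by simp
  then show "rat_defined_at (const_fun d) a" "rat_eval (const_fun d) a = d"
    unfolding rat_defined_at_def const_fun_def by (blast, simp add: rat_eval_Fract)
qed

lemma const_fun_mult: "const_fun (a * b) = const_fun a * const_fun b"
  by (simp add: const_fun_def mult.commute)

lemma const_fun_inject [simp]: "const_fun a = const_fun b \<longleftrightarrow> a = b"
  by (simp add: const_fun_def eq_fract)

lemma const_fun_0 [simp]: "const_fun 0 = 0"
  by (simp add: const_fun_def fract_collapse)

lemma const_fun_1 [simp]: "const_fun 1 = 1"
  by (simp add: const_fun_def One_fract_def pCons_one)

lemma const_fun_inverse: "const_fun (inverse a) = inverse (const_fun a)"
proof (cases "a = 0")
  case False
  then have "const_fun a * const_fun (inverse a) = 1" by (simp flip: const_fun_mult)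
  then show ?thesis by (simp add: inverse_unique)
qed simp

section \<open>Rational functions over a subfield\<close>

locale coefficient_field =
  fixes K :: "'a::field set"
  assumes K_0: "0 \<in> K" and K_1: "1 \<in> K"
    and K_add: "x \<in> K \<Longrightarrow> y \<in> K \<Longrightarrow> x + y \<in> K"
    and K_uminus: "x \<in> K \<Longrightarrow> - x \<in> K"
    and K_mult: "x \<in> K \<Longrightarrow> y \<in> K \<Longrightarrow> x * y \<in> K"
    and K_inverse: "x \<in> K \<Longrightarrow> inverse x \<in> K"
begin

lemma K_diff: "x \<in> K \<Longrightarrow> y \<in> K \<Longrightarrow> x - y \<in> K"
  using K_add[of x "- y"] K_uminus by simp

lemma K_sum: "(\<And>i. i \<in> I \<Longrightarrow> f i \<in> K) \<Longrightarrow> sum f I \<in> K"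
  by (induction I rule: infinite_finite_induct) (auto intro: K_0 K_add)

definition "Kpoly = {p. \<forall>i. coeff p i \<in> K}"

lemma Kpoly_pCons: "pCons c p \<in> Kpoly \<longleftrightarrow> c \<in> K \<and> p \<in> Kpoly"
  by (auto simp: Kpoly_def coeff_pCons split: nat.splits)

lemma Kpoly_0: "0 \<in> Kpoly" and Kpoly_1: "1 \<in> Kpoly"
  by (simp_all add: Kpoly_def K_0 K_1 coeff_1)

lemma Kpoly_add: "p \<in> Kpoly \<Longrightarrow> q \<in> Kpoly \<Longrightarrow> p + q \<in> Kpoly"
  by (simp add: Kpoly_def K_add)

lemma Kpoly_mult: "p \<in> Kpoly \<Longrightarrow> q \<in> Kpoly \<Longrightarrow> p * q \<in> Kpoly"
  by (simp add: Kpoly_def coeff_mult K_sum K_mult)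

lemma Kpoly_smult: "c \<in> K \<Longrightarrow> p \<in> Kpoly \<Longrightarrow> smult c p \<in> Kpoly"
  by (simp add: Kpoly_def K_mult)

lemma Kpoly_pcompose: "p \<in> Kpoly \<Longrightarrow> q \<in> Kpoly \<Longrightarrow> pcompose p q \<in> Kpoly"
  by (induction p) (auto simp: pcompose_pCons Kpoly_pCons Kpoly_0 intro!: Kpoly_add Kpoly_mult)

lemma poly_Kpoly: "p \<in> Kpoly \<Longrightarrow> x \<in> K \<Longrightarrow> poly p x \<in> K"
  by (induction p) (auto simp: Kpoly_pCons K_0 intro!: K_add K_mult)

lemma rational_functions_iff:
  "\<phi> \<in> rational_functions K \<longleftrightarrow> (\<exists>p q. \<phi> = Fract p q \<and> q \<noteq> 0 \<and> p \<in> Kpoly \<and> q \<in> Kpoly)"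
  by (auto simp: rational_functions_def Kpoly_def)

lemma rational_functions_mult:
  assumes "\<phi> \<in> rational_functions K" "\<psi> \<in> rational_functions K"
  shows "\<phi> * \<psi> \<in> rational_functions K"
proof -
  obtain p q p' q' where "\<phi> = Fract p q" "q \<noteq> 0" "p \<in> Kpoly" "q \<in> Kpoly"
      "\<psi> = Fract p' q'" "q' \<noteq> 0" "p' \<in> Kpoly" "q' \<in> Kpoly"
    using assms unfolding rational_functions_iff by blast
  then show ?thesis unfolding rational_functions_iff
    by (intro exI[of _ "p * p'"] exI[of _ "q * q'"]) (auto intro: Kpoly_mult)
qed

lemma rational_functions_inverse:
  assumes "\<phi> \<in> rational_functions K" shows "inverse \<phi> \<in> rational_functions K"
proof -
  obtain p q where *: "\<phi> = Fract p q" "q \<noteq> 0" "p \<in> Kpoly" "q \<in> Kpoly"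
    using assms unfolding rational_functions_iff by blast
  show ?thesis
  proof (cases "p = 0")
    case True
    then show ?thesis using assms * by (simp add: fract_collapse)
  next
    case False
    then show ?thesis using * unfolding rational_functions_iff by auto
  qed
qed

lemma rational_functions_const: "c \<in> K \<Longrightarrow> const_fun c \<in> rational_functions K"
  unfolding rational_functions_iff const_fun_def
  by (intro exI[of _ "[:c:]"] exI[of _ 1]) (auto simp: Kpoly_pCons Kpoly_0 Kpoly_1)

end

text \<open>The positive elements have infimum 0: otherwise two of them below twice the infimum
  would differ by a positive element smaller than the infimum. Integer multiples of arbitrarily
  small elements then meet every interval.\<close>

lemma no_minimal_imp_dense:
  fixes G :: "real set"
  assumes add: "\<And>x y. x \<in> G \<Longrightarrow> y \<in> G \<Longrightarrow> x + y \<in> G" and neg: "\<And>x. x \<in> G \<Longrightarrow> - x \<in> G"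
    and pos: "g \<in> G" "0 < g"
    and no_min: "\<not> (\<exists>\<gamma>\<in>G. 0 < \<gamma> \<and> (\<forall>\<delta>\<in>G. 0 < \<delta> \<longrightarrow> \<gamma> \<le> \<delta>))"
    and "x < y"
  shows "infinite (G \<inter> {x<..<y})"
proof -
  define P where "P = {\<gamma> \<in> G. 0 < \<gamma>}"
  have P: "P \<noteq> {}" "bdd_below P" using pos by (auto simp: P_def intro!: bdd_belowI[of _ 0])
  have small: "\<exists>\<delta>\<in>P. \<delta> < e" if e: "0 < e" for e
  proof (cases "Inf P < e")
    case True
    then show ?thesis using cInf_lessD[OF P(1)] by blast
  next
    case False
    then have "Inf P < 2 * Inf P" using e by simp
    then obtain \<gamma> where \<gamma>: "\<gamma> \<in> P" "\<gamma> < 2 * Inf P" using cInf_lessD[OF P(1)] by blast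
    then obtain \<delta> where \<delta>: "\<delta> \<in> P" "\<delta> < \<gamma>" using no_min unfolding P_def by force
    then have "\<gamma> - \<delta> \<in> P" using \<gamma> add[of \<gamma> "- \<delta>"] neg by (auto simp: P_def)
    then have "Inf P \<le> \<gamma> - \<delta>" "Inf P \<le> \<delta>" using \<delta> P(2) by (auto intro: cInf_lower)
    then show ?thesis using \<gamma> by simp
  qed
  have zero: "0 \<in> G" using add[OF pos(1) neg[OF pos(1)]] by simp
  have nat: "real n * \<delta> \<in> G" if "\<delta> \<in> G" for n \<delta>
    by (induction n) (use that zero add in \<open>auto simp: distrib_right\<close>)
  have int: "of_int n * \<delta> \<in> G" if "\<delta> \<in> G" for n \<delta>
    using nat[OF that, of "nat \<bar>n\<bar>"] neg[of "real (nat \<bar>n\<bar>) * \<delta>"] by (cases "0 \<le> n") auto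
  have dense: "G \<inter> {u<..<w} \<noteq> {}" if uw: "u < w" for u w
  proof -
    obtain \<delta> where \<delta>: "\<delta> \<in> G" "0 < \<delta>" "\<delta> < w - u" using small[of "w - u"] uw by (auto simp: P_def)
    define n where "n = \<lfloor>u / \<delta>\<rfloor> + 1"
    have "u / \<delta> < of_int n" "of_int n \<le> u / \<delta> + 1" unfolding n_def by linarith+
    then have "u < of_int n * \<delta>" "of_int n * \<delta> \<le> u + \<delta>" using \<delta> by (simp_all add: field_simps)
    then have "of_int n * \<delta> \<in> G \<inter> {u<..<w}" using int[OF \<delta>(1)] \<delta> by auto
    then show ?thesis by blast
  qed
  show ?thesis
  proof
    \<comment> \<open>Finitely many elements would have a least one \<open>m\<close>, yet the
      interval from \<open>x\<close> to \<open>m\<close> is met as well.\<close>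
    assume fin: "finite (G \<inter> {x<..<y})"
    define m where "m = Min (G \<inter> {x<..<y})"
    have m: "m \<in> G \<inter> {x<..<y}" unfolding m_def using fin dense[OF \<open>x < y\<close>] by (rule Min_in)
    then obtain l where "l \<in> G" "x < l" "l < m" using dense[of x m] by auto
    then show False using Min_le[OF fin, of l] m unfolding m_def[symmetric] by auto
  qed
qed

subsection \<open>The domain \<open>D\<close>\<close>

locale truncated_monoid_domain =
  fixes \<Gamma> M :: "real set"
    and D K :: "(real \<Rightarrow>\<^sub>0 'k::field) fract set"
  assumes subgroup: "additive_subgroup \<Gamma> (ring_of_type_algebra :: real ring)"
    and no_min: "\<not> (\<exists>\<gamma>\<in>\<Gamma>. 0 < \<gamma> \<and> (\<forall>\<delta>\<in>\<Gamma>. 0 < \<delta> \<longrightarrow> \<gamma> \<le> \<delta>))"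
    and one: "1 \<in> \<Gamma>"
    and M: "M = {0} \<union> {\<gamma> \<in> \<Gamma>. \<gamma> \<ge> 1}"
    and D: "D = localized_monoid_ring M"
    and K: "K = fraction_field_of D"
begin

lemma \<Gamma>_add: "x \<in> \<Gamma> \<Longrightarrow> y \<in> \<Gamma> \<Longrightarrow> x + y \<in> \<Gamma>"
  using additive_subgroup.a_closed[OF subgroup] by simp

lemma \<Gamma>_uminus: "x \<in> \<Gamma> \<Longrightarrow> - x \<in> \<Gamma>"
  using additive_subgroup.a_inv_closed[OF subgroup] by (auto simp: a_inv_ring_of_type_algebra)

lemma \<Gamma>_diff: "x \<in> \<Gamma> \<Longrightarrow> y \<in> \<Gamma> \<Longrightarrow> x - y \<in> \<Gamma>"
  using \<Gamma>_add[of x "- y"] \<Gamma>_uminus by simp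

lemma \<Gamma>_0: "0 \<in> \<Gamma>"
  using \<Gamma>_diff[OF one one] by simp

lemma \<Gamma>_mult_nat: "x \<in> \<Gamma> \<Longrightarrow> real n * x \<in> \<Gamma>"
  by (induction n) (auto simp: \<Gamma>_0 distrib_right intro: \<Gamma>_add)

lemma \<Gamma>_of_nat: "real n \<in> \<Gamma>"
  using \<Gamma>_mult_nat[OF one, of n] by simp

lemma \<Gamma>_dense: "x < y \<Longrightarrow> infinite (\<Gamma> \<inter> {x<..<y})"
  by (rule no_minimal_imp_dense[of \<Gamma> 1]) (use \<Gamma>_add \<Gamma>_uminus one no_min in auto)

lemma M_subset: "M \<subseteq> \<Gamma>" and M_nonneg: "M \<subseteq> {0..}" and M_0: "0 \<in> M"
  using \<Gamma>_0 by (auto simp: M)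

lemma M_add: "a \<in> M \<Longrightarrow> b \<in> M \<Longrightarrow> a + b \<in> M"
  using \<Gamma>_add by (auto simp: M)

lemma gp_M: "gp M = \<Gamma>"
proof (intro equalityI subsetI)
  fix x assume "x \<in> gp M" then show "x \<in> \<Gamma>" using M_subset \<Gamma>_diff by (auto simp: gp_def)
next
  fix x assume x: "x \<in> \<Gamma>"
  \<comment> \<open>The integer is large enough that both \<open>x + N\<close> and \<open>N\<close>
    are at least 1, hence in \<open>M\<close>, and \<open>x\<close> is their difference.\<close>
  define N where "N = nat \<lceil>\<bar>x\<bar>\<rceil> + 1"
  have "\<bar>x\<bar> + 1 \<le> real N" unfolding N_def by linarith
  then have "x + real N \<in> M" "real N \<in> M" using x \<Gamma>_of_nat \<Gamma>_add by (auto simp: M)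
  then show "x \<in> gp M" unfolding gp_def by (intro CollectI exI[of _ "x + real N"] exI[of _ "real N"]) simp
qed

section \<open>The monoid ring and its localization\<close>

lemma monoid_ring_mult: "f \<in> monoid_ring M \<Longrightarrow> g \<in> monoid_ring M \<Longrightarrow> f * g \<in> monoid_ring M"
  using keys_subset_mult[of f M g M M] M_add by (auto simp: monoid_ring_def)

lemma monoid_ring_diff: "f \<in> monoid_ring M \<Longrightarrow> g \<in> monoid_ring M \<Longrightarrow> f - g \<in> monoid_ring M"
  using keys_subset_diff[of f M g] by (auto simp: monoid_ring_def)

lemma monoid_ring_lookup_mult:
  "f \<in> monoid_ring M \<Longrightarrow> g \<in> monoid_ring M \<Longrightarrow>
    Poly_Mapping.lookup (f * g) 0 = Poly_Mapping.lookup f 0 * Poly_Mapping.lookup g 0"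
  using M_nonneg by (intro lookup_mult_0) (auto simp: monoid_ring_def)

lemma single_monoid_ring: "a \<in> M \<Longrightarrow> Poly_Mapping.single a c \<in> monoid_ring M"
  by (auto simp: monoid_ring_def)

text \<open>The constant coefficient is a ring homomorphism whose kernel contains the generators,
  hence the whole ideal. Conversely, an element without constant term is a sum of monomials with
  exponents in \<open>M - {0}\<close>, each a multiple of a generator.\<close>

lemma monoid_ideal_iff:
  fixes g :: "real \<Rightarrow>\<^sub>0 'k"
  assumes g: "g \<in> monoid_ring M"
  shows "g \<in> monoid_ideal M \<longleftrightarrow> Poly_Mapping.lookup g 0 = 0"
proof
  let ?R = "ring_on (monoid_ring M) :: (real \<Rightarrow>\<^sub>0 'k) ring"
  have one: "1 \<in> monoid_ring M" using M_0 by (auto simp: monoid_ring_def)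
  have R: "ring ?R"
    using one by (intro ring_ring_on monoid_ring_mult)
      (simp_all add: monoid_ring_def keys_uminus_eq keys_subset_add)
  assume "g \<in> monoid_ideal M"
  then have gen: "g \<in> I" if "ideal I ?R" "{Poly_Mapping.single \<alpha> 1 | \<alpha>. \<alpha> \<in> M - {0}} \<subseteq> I" for I
    using that by (auto simp: monoid_ideal_def genideal_def)
  have "ring_hom_ring ?R (ring_of_type_algebra :: 'k ring) (\<lambda>f. Poly_Mapping.lookup f 0)"
    by (rule ring_hom_ringI2[OF R ring_from_type_algebra])
      (auto simp: ring_hom_def monoid_ring_lookup_mult lookup_add, simp_all add: ring_of_type_algebra_def)
  then have "ideal (a_kernel ?R (ring_of_type_algebra :: 'k ring) (\<lambda>f. Poly_Mapping.lookup f 0)) ?R"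
    by (rule ring_hom_ring.kernel_is_ideal)
  moreover have "a_kernel ?R (ring_of_type_algebra :: 'k ring) (\<lambda>f. Poly_Mapping.lookup f 0) =
      {f \<in> monoid_ring M. Poly_Mapping.lookup f 0 = 0}"
    unfolding a_kernel_def' by (simp add: ring_of_type_algebra_def)
  ultimately have "g \<in> {f \<in> monoid_ring M. Poly_Mapping.lookup f 0 = 0}"
    using single_monoid_ring by (intro gen) (auto simp: lookup_single)
  then show "Poly_Mapping.lookup g 0 = 0" by simp
next
  let ?R = "ring_on (monoid_ring M) :: (real \<Rightarrow>\<^sub>0 'k) ring"
  assume g0: "Poly_Mapping.lookup g 0 = 0"
  have "g \<in> I" if I: "ideal I ?R" "{Poly_Mapping.single \<alpha> 1 | \<alpha>. \<alpha> \<in> M - {0}} \<subseteq> I" for I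
  proof -
    interpret ideal I ?R by (rule I(1))
    have single: "Poly_Mapping.single a (c :: 'k) \<in> I" if "a \<in> M - {0}" for a c
    proof -
      have "Poly_Mapping.single 0 c * Poly_Mapping.single a 1 \<in> I"
        using I_l_closed[of "Poly_Mapping.single a 1" "Poly_Mapping.single 0 c"] I(2) that
          single_monoid_ring[OF M_0] by auto
      then show ?thesis by (simp add: mult_single)
    qed
    have "(\<Sum>a\<in>A. Poly_Mapping.single a (Poly_Mapping.lookup g a)) \<in> I"
      if "finite A" "A \<subseteq> Poly_Mapping.keys g" for A
      using that
    proof (induction A rule: finite_induct)
      case empty
      then show ?case using additive_subgroup.zero_closed[OF is_additive_subgroup] by simp
    next
      case (insert a A)
      then have "a \<in> M - {0}" using g g0 by (auto simp: monoid_ring_def in_keys_iff)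
      then show ?case using additive_subgroup.a_closed[OF is_additive_subgroup single] insert by simp
    qed
    then show "g \<in> I" using poly_mapping_eq_sum_single[of g] by (metis finite_keys order_refl)
  qed
  then show "g \<in> monoid_ideal M" by (auto simp: monoid_ideal_def genideal_def)
qed

lemma D_iff:
  "x \<in> D \<longleftrightarrow> (\<exists>f g. f \<in> monoid_ring M \<and> g \<in> monoid_ring M \<and> Poly_Mapping.lookup g 0 \<noteq> 0 \<and> x = Fract f g)"
  unfolding D localized_monoid_ring_def using monoid_ideal_iff by blast

section \<open>The group ring and the field \<open>K\<close>\<close>

definition "group_ring = {f :: real \<Rightarrow>\<^sub>0 'k. Poly_Mapping.keys f \<subseteq> \<Gamma>}"

lemma group_ring_mult: "f \<in> group_ring \<Longrightarrow> g \<in> group_ring \<Longrightarrow> f * g \<in> group_ring"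
  using keys_subset_mult[of f \<Gamma> g \<Gamma> \<Gamma>] \<Gamma>_add by (auto simp: group_ring_def)

lemma group_ring_add: "f \<in> group_ring \<Longrightarrow> g \<in> group_ring \<Longrightarrow> f + g \<in> group_ring"
  using keys_subset_add[of f \<Gamma> g] by (auto simp: group_ring_def)

lemma group_ring_single: "a \<in> \<Gamma> \<Longrightarrow> Poly_Mapping.single a c \<in> group_ring"
  by (simp add: group_ring_def)

lemma monoid_ring_subset: "monoid_ring M \<subseteq> group_ring"
  using M_subset by (auto simp: monoid_ring_def group_ring_def)

text \<open>A large power of \<open>t\<close> moves all exponents to at least 1, hence into
  \<open>M\<close>. As every larger power works too, one shift serves both numerator and denominator
  in \<open>K_iff\<close>.\<close>

lemma exists_shift_monoid_ring:
  assumes "f \<in> group_ring"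
  shows "\<exists>N. \<forall>n\<ge>N. Poly_Mapping.single (real n) 1 * f \<in> monoid_ring M"
proof (cases "f = 0")
  case False
  define N where "N = nat \<lceil>1 - min_exponent f\<rceil>"
  have "Poly_Mapping.keys (Poly_Mapping.single (real n) 1 * f) \<subseteq> M" if n: "N \<le> n" for n
  proof (rule keys_subset_mult[of _ "{real n}" _ "Poly_Mapping.keys f"])
    fix a b assume "a \<in> {real n}" "b \<in> Poly_Mapping.keys f"
    moreover have "1 - min_exponent f \<le> real n" using n unfolding N_def by linarith
    ultimately show "a + b \<in> M"
      using assms min_exponent_le[of b f] \<Gamma>_add[of a b] \<Gamma>_of_nat by (auto simp: M group_ring_def)
  qed auto
  then show ?thesis by (auto simp: monoid_ring_def)
qed (simp add: monoid_ring_def)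

lemma D_1: "1 \<in> D"
  unfolding D_iff One_fract_def using M_0 by (intro exI[of _ 1]) (auto simp: monoid_ring_def)

lemma Fract_one_D: "f \<in> monoid_ring M \<Longrightarrow> Fract f 1 \<in> D"
  unfolding D_iff using M_0 by (intro exI[of _ f] exI[of _ 1]) (auto simp: monoid_ring_def)

lemma D_mult:
  assumes "x \<in> D" "y \<in> D" shows "x * y \<in> D"
proof -
  obtain f g f' g' where *: "f \<in> monoid_ring M" "g \<in> monoid_ring M" "Poly_Mapping.lookup g 0 \<noteq> 0" "x = Fract f g"
    "f' \<in> monoid_ring M" "g' \<in> monoid_ring M" "Poly_Mapping.lookup g' 0 \<noteq> 0" "y = Fract f' g'"
    using assms unfolding D_iff by blast
  then have "x * y = Fract (f * f') (g * g')" "Poly_Mapping.lookup (g * g') 0 \<noteq> 0"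
    by (simp_all add: monoid_ring_lookup_mult)
  then show ?thesis unfolding D_iff using * monoid_ring_mult by blast
qed

lemma D_diff_1:
  assumes "x \<in> D" shows "x - 1 \<in> D"
proof -
  obtain f g where *: "f \<in> monoid_ring M" "g \<in> monoid_ring M" "Poly_Mapping.lookup g 0 \<noteq> 0" "x = Fract f g"
    using assms unfolding D_iff by blast
  then have "g \<noteq> 0" by auto
  then have "x - 1 = Fract (f - g) g" using * by (simp add: One_fract_def)
  then show ?thesis unfolding D_iff using * monoid_ring_diff by blast
qed

lemma K_iff: "x \<in> K \<longleftrightarrow> (\<exists>f g. f \<in> group_ring \<and> g \<in> group_ring \<and> g \<noteq> 0 \<and> x = Fract f g)"
proof
  assume "x \<in> K"
  then obtain a b where ab: "a \<in> D" "b \<in> D" "b \<noteq> 0" "x = a / b"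
    unfolding K fraction_field_of_def by blast
  then obtain f g f' g' where *: "f \<in> monoid_ring M" "g \<in> monoid_ring M" "Poly_Mapping.lookup g 0 \<noteq> 0" "a = Fract f g"
    "f' \<in> monoid_ring M" "g' \<in> monoid_ring M" "Poly_Mapping.lookup g' 0 \<noteq> 0" "b = Fract f' g'"
    unfolding D_iff by blast
  then have "g \<noteq> 0" "f' \<noteq> 0" using ab(3) by (auto simp: fract_collapse)
  then show "\<exists>f g. f \<in> group_ring \<and> g \<in> group_ring \<and> g \<noteq> 0 \<and> x = Fract f g"
    using * monoid_ring_subset group_ring_mult ab(4)
    by (intro exI[of _ "f * g'"] exI[of _ "g * f'"]) auto
next
  assume "\<exists>f g. f \<in> group_ring \<and> g \<in> group_ring \<and> g \<noteq> 0 \<and> x = Fract f g"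
  then obtain f g where fg: "f \<in> group_ring" "g \<in> group_ring" "g \<noteq> 0" "x = Fract f g" by blast
  obtain N where N: "\<forall>n\<ge>N. Poly_Mapping.single (real n) 1 * f \<in> monoid_ring M"
    using exists_shift_monoid_ring fg by blast
  obtain N' where N': "\<forall>n\<ge>N'. Poly_Mapping.single (real n) 1 * g \<in> monoid_ring M"
    using exists_shift_monoid_ring fg by blast
  define s :: "real \<Rightarrow>\<^sub>0 'k" where "s = Poly_Mapping.single (real (max N N')) 1"
  have s: "s \<noteq> 0" "s * f \<in> monoid_ring M" "s * g \<in> monoid_ring M" using N N' unfolding s_def by auto
  have "x = Fract (s * f) 1 / Fract (s * g) 1" using s fg by (simp add: mult_fract_cancel)
  moreover have "Fract (s * g) 1 \<noteq> 0" using s fg by (simp add: Fract_eq_0_iff)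
  ultimately show "x \<in> K" unfolding K fraction_field_of_def using Fract_one_D s by blast
qed

lemma tpow_K: "a \<in> \<Gamma> \<Longrightarrow> tpow a \<in> K"
  unfolding K_iff tpow_def using group_ring_single \<Gamma>_0
  by (intro exI[of _ "Poly_Mapping.single a 1"] exI[of _ 1]) (auto simp: group_ring_def)

lemma const_fract_K: "const_fract c \<in> K"
  unfolding K_iff const_fract_def using group_ring_single \<Gamma>_0
  by (intro exI[of _ "Poly_Mapping.single 0 c"] exI[of _ 1]) (auto simp: group_ring_def)

lemma D_subset_K: "D \<subseteq> K"
  unfolding K fraction_field_of_def using D_1 by force

sublocale coefficient_field K
proof
  show "0 \<in> K" using const_fract_K[of 0] by (simp add: const_fract_hom)
  show "1 \<in> K" using D_subset_K D_1 by blast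
  fix x y assume "x \<in> K" "y \<in> K"
  then obtain f g f' g' where *: "f \<in> group_ring" "g \<in> group_ring" "g \<noteq> 0" "x = Fract f g"
    "f' \<in> group_ring" "g' \<in> group_ring" "g' \<noteq> 0" "y = Fract f' g'"
    unfolding K_iff by blast
  show "x + y \<in> K" unfolding K_iff using *
    by (intro exI[of _ "f * g' + f' * g"] exI[of _ "g * g'"]) (auto intro: group_ring_mult group_ring_add)
  show "x * y \<in> K" unfolding K_iff using *
    by (intro exI[of _ "f * f'"] exI[of _ "g * g'"]) (auto intro: group_ring_mult)
next
  fix x assume "x \<in> K"
  then obtain f g where *: "f \<in> group_ring" "g \<in> group_ring" "g \<noteq> 0" "x = Fract f g"
    unfolding K_iff by blast
  show "- x \<in> K" unfolding K_iff using *
    by (intro exI[of _ "- f"] exI[of _ g]) (auto simp: group_ring_def keys_uminus_eq)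
  show "inverse x \<in> K"
  proof (cases "f = 0")
    case True
    then show ?thesis using \<open>x \<in> K\<close> * by (simp add: fract_collapse)
  next
    case False
    then show ?thesis unfolding K_iff using * by (intro exI[of _ g] exI[of _ f]) auto
  qed
qed

lemma K_divide: "x \<in> K \<Longrightarrow> y \<in> K \<Longrightarrow> x / y \<in> K"
  by (simp add: divide_inverse K_mult K_inverse)

lemma mval_K:
  assumes "x \<in> K" "x \<noteq> 0" shows "\<exists>g\<in>\<Gamma>. mval x = ereal g"
proof -
  obtain f g where *: "f \<in> group_ring" "g \<in> group_ring" "g \<noteq> 0" "x = Fract f g"
    using assms unfolding K_iff by blast
  then have "f \<noteq> 0" using assms by (auto simp: fract_collapse)
  then show ?thesis using * min_exponent_in_keys[of f] min_exponent_in_keys[of g] \<Gamma>_diff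
    by (intro bexI[of _ "min_exponent f - min_exponent g"]) (auto simp: mval_Fract group_ring_def)
qed

section \<open>Description of \<open>D\<close> by values\<close>

lemma min_exponent_eq_0:
  assumes "g \<in> monoid_ring M" "Poly_Mapping.lookup g 0 \<noteq> 0" shows "min_exponent g = 0"
proof -
  have "g \<noteq> 0" using assms by auto
  then have "min_exponent g \<in> M" using min_exponent_in_keys assms by (auto simp: monoid_ring_def)
  then show ?thesis using min_exponent_le[of 0 g] assms M_nonneg by (force simp: in_keys_iff)
qed

lemma min_exponent_ge_1:
  assumes "f \<in> monoid_ring M" "Poly_Mapping.lookup f 0 = 0" "f \<noteq> 0" shows "1 \<le> min_exponent f"
proof -
  have "min_exponent f \<in> M" "min_exponent f \<noteq> 0"
    using min_exponent_in_keys[OF assms(3)] assms by (auto simp: monoid_ring_def in_keys_iff)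
  then show ?thesis by (auto simp: M)
qed

text \<open>The denominator has value 0. The numerator has value 0 exactly when its constant term is
  nonzero, and then the fraction may be inverted; otherwise its exponents are at least 1, as
  \<open>M\<close> has none strictly between 0 and 1.\<close>

lemma D_cases:
  assumes "x \<in> D"
  shows "mval x = 0 \<and> inverse x \<in> D \<or> 1 \<le> mval x"
proof -
  obtain f g where *: "f \<in> monoid_ring M" "g \<in> monoid_ring M" "Poly_Mapping.lookup g 0 \<noteq> 0" "x = Fract f g"
    using assms unfolding D_iff by blast
  have g: "g \<noteq> 0" "min_exponent g = 0" using * min_exponent_eq_0 by auto
  consider "f = 0" | "f \<noteq> 0" "Poly_Mapping.lookup f 0 = 0" | "f \<noteq> 0" "Poly_Mapping.lookup f 0 \<noteq> 0" by blast
  then show ?thesis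
  proof cases
    case 1
    then show ?thesis using * by (simp add: fract_collapse)
  next
    case 2
    then show ?thesis using * g min_exponent_ge_1[of f] by (simp add: mval_Fract one_ereal_def)
  next
    case 3
    then have "mval x = 0" using * g min_exponent_eq_0[of f] by (simp add: mval_Fract zero_ereal_def)
    moreover have "inverse x \<in> D" unfolding D_iff using * 3
      by (intro exI[of _ g] exI[of _ f]) simp
    ultimately show ?thesis by simp
  qed
qed

text \<open>
  A geometric series argument: modulo \<open>t\<^sup>1\<close>, a denominator \<open>1 - h\<close> with \<open>v(h) > 0\<close> is inverted by
  \<open>1 + h + \<dots> + h\<^sup>n\<^sup>-\<^sup>1\<close>, since \<open>v(h\<^sup>n) \<ge> 1\<close> for large \<open>n\<close>.
\<close>

lemma mval_ge_1_D:
  assumes "x \<in> K" "1 \<le> mval x"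
  shows "x \<in> D"
proof (cases "x = 0")
  case True
  have "Fract 0 1 \<in> D" by (rule Fract_one_D) (simp add: monoid_ring_def)
  then show ?thesis using True by (simp add: fract_collapse)
next
  case False
  obtain f0 g0 where *: "f0 \<in> group_ring" "g0 \<in> group_ring" "g0 \<noteq> 0" "x = Fract f0 g0"
    using assms unfolding K_iff by blast
  then have "f0 \<noteq> 0" using False by (auto simp: fract_collapse)
  define m where "m = min_exponent g0"
  \<comment> \<open>Multiplying by \<open>s\<close> turns the lowest term of the denominator into 1
    and does not change the fraction.\<close>
  define s where "s = Poly_Mapping.single (- m) (1 / Poly_Mapping.lookup g0 m)"
  have m: "m \<in> Poly_Mapping.keys g0" using min_exponent_in_keys * by (simp add: m_def)
  then have mG: "m \<in> \<Gamma>" "Poly_Mapping.lookup g0 m \<noteq> 0" using * by (auto simp: group_ring_def in_keys_iff)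
  have s: "s \<in> group_ring" "s \<noteq> 0" "min_exponent s = - m"
    using mG \<Gamma>_uminus by (auto simp: s_def group_ring_single)
  define f where "f = s * f0"
  define g where "g = s * g0"
  have fg: "f \<in> group_ring" "g \<in> group_ring" "f \<noteq> 0" "g \<noteq> 0" "x = Fract f g"
    using * s \<open>f0 \<noteq> 0\<close> by (auto simp: f_def g_def group_ring_mult mult_fract_cancel)
  have ming: "min_exponent g = 0" using s * by (simp add: g_def min_exponent_mult m_def)
  have minf: "1 \<le> min_exponent f"
    using assms(2) fg ming by (simp add: mval_Fract one_ereal_def)
  define h where "h = 1 - g"
  have "Poly_Mapping.lookup g 0 = 1"
  proof -
    have "g = s * (\<Sum>a\<in>Poly_Mapping.keys g0. Poly_Mapping.single a (Poly_Mapping.lookup g0 a))"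
      using poly_mapping_eq_sum_single[of g0] by (simp add: g_def)
    also have "\<dots> = (\<Sum>a\<in>Poly_Mapping.keys g0.
        Poly_Mapping.single (a - m) (Poly_Mapping.lookup g0 a / Poly_Mapping.lookup g0 m))"
      by (simp add: s_def sum_distrib_left mult_single)
    also have "Poly_Mapping.lookup \<dots> 0 = (\<Sum>a\<in>Poly_Mapping.keys g0.
        if a = m then Poly_Mapping.lookup g0 a / Poly_Mapping.lookup g0 m else 0)"
      unfolding lookup_sum by (intro sum.cong) (auto simp: lookup_single when_def)
    also have "\<dots> = 1" using m mG by simp
    finally show ?thesis .
  qed
  then have h0: "Poly_Mapping.lookup h 0 = 0" by (simp add: h_def lookup_minus)
  have hpos: "0 < a" "a \<in> \<Gamma>" if a: "a \<in> Poly_Mapping.keys h" for a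
  proof -
    have "a \<noteq> 0" using a h0 by (auto simp: in_keys_iff)
    then have "a \<in> Poly_Mapping.keys g"
      using a by (auto simp: h_def in_keys_iff lookup_minus lookup_one when_def)
    then show "0 < a" "a \<in> \<Gamma>" using min_exponent_le[of a g] ming \<open>a \<noteq> 0\<close> fg by (auto simp: group_ring_def)
  qed
  \<comment> \<open>A common positive lower bound for the exponents of \<open>h\<close>, so that
    those of \<open>h ^ i\<close> are at least \<open>i * e\<close>; for \<open>h = 0\<close> any
    number serves.\<close>
  obtain e where e: "0 < e" "\<forall>a\<in>Poly_Mapping.keys h. e \<le> a"
  proof (cases "h = 0")
    case False
    then show ?thesis
      using that[of "min_exponent h"] hpos[OF min_exponent_in_keys] min_exponent_le by blast
  qed (use that[of 1] in simp)
  obtain n :: nat where n: "1 \<le> real n * e" using reals_Archimedean3[OF e(1)] less_imp_le by blast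
  have hpow: "Poly_Mapping.keys (h ^ i) \<subseteq> {a \<in> \<Gamma>. real i * e \<le> a}" for i
  proof (induction i)
    case (Suc i)
    have "Poly_Mapping.keys h \<subseteq> {a \<in> \<Gamma>. e \<le> a}" using hpos e by blast
    then have "Poly_Mapping.keys (h * h ^ i) \<subseteq> {a \<in> \<Gamma>. real (Suc i) * e \<le> a}"
      by (rule keys_subset_mult[OF _ Suc]) (auto simp: distrib_right intro: \<Gamma>_add)
    then show ?case by simp
  qed (use \<Gamma>_0 in auto)
  \<comment> \<open>Extending the fraction by \<open>S\<close> moves it into \<open>k[t;M]\<close>:
    \<open>g * S = 1 - h ^ n\<close> has exponents 0 or at least 1, and \<open>f * S\<close> has
    exponents at least 1 because those of \<open>S\<close> are nonnegative.\<close>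
  define S where "S = (\<Sum>i<n. h ^ i)"
  have gS: "g * S = 1 - h ^ n"
    using one_diff_power_eq[of h n] by (simp add: S_def h_def)
  have hn: "h ^ n \<in> monoid_ring M" "Poly_Mapping.lookup (h ^ n) 0 = 0"
    using hpow[of n] n by (auto simp: monoid_ring_def M in_keys_iff)
  have S: "Poly_Mapping.keys S \<subseteq> {a \<in> \<Gamma>. 0 \<le> a}" unfolding S_def
  proof (rule keys_subset_sum)
    fix i
    have "0 \<le> real i * e" using e by simp
    then show "Poly_Mapping.keys (h ^ i) \<subseteq> {a \<in> \<Gamma>. 0 \<le> a}" using hpow[of i] by force
  qed
  have "Poly_Mapping.keys (f * S) \<subseteq> {a \<in> \<Gamma>. 1 \<le> a}"
    by (rule keys_subset_mult[OF _ S, of _ "{a \<in> \<Gamma>. 1 \<le> a}"])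
      (use fg minf min_exponent_le[of _ f] in \<open>force simp: group_ring_def intro: \<Gamma>_add\<close>)+
  then have "f * S \<in> monoid_ring M" by (auto simp: monoid_ring_def M)
  moreover have lgS: "Poly_Mapping.lookup (g * S) 0 = 1" unfolding gS by (simp add: lookup_minus hn)
  moreover have "g * S \<in> monoid_ring M" unfolding gS
    by (rule monoid_ring_diff[OF _ hn(1)]) (use M_0 in \<open>simp add: monoid_ring_def\<close>)
  moreover have "x = Fract (f * S) (g * S)"
  proof -
    have "S \<noteq> 0" using lgS by auto
    then show ?thesis using fg mult_fract_cancel[of S f g] by (simp add: mult.commute)
  qed
  ultimately show ?thesis unfolding D_iff by (intro exI[of _ "f * S"] exI[of _ "g * S"]) simp
qed

text \<open>Guarantees that a nonzero rational function does not vanish on all of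
  \<open>K\<close>.\<close>

lemma K_infinite: "infinite K"
proof
  assume "finite K"
  moreover have "tpow ` (\<Gamma> \<inter> {0<..<1}) \<subseteq> K" using tpow_K by blast
  ultimately have "finite (tpow ` (\<Gamma> \<inter> {0<..<1}) :: (real \<Rightarrow>\<^sub>0 'k) fract set)" by (rule finite_subset[rotated])
  moreover have "inj (tpow :: _ \<Rightarrow> (real \<Rightarrow>\<^sub>0 'k) fract)" by (metis injI mval_tpow ereal.inject)
  ultimately show False using \<Gamma>_dense[of 0 1] by (simp add: finite_image_iff inj_on_subset)
qed

subsection \<open>Integer-valued rational functions on \<open>K\<close>\<close>

abbreviation "I \<equiv> Int_R K D"

lemma Int_defined: "\<phi> \<in> I \<Longrightarrow> a \<in> K \<Longrightarrow> rat_defined_at \<phi> a"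
  and Int_eval: "\<phi> \<in> I \<Longrightarrow> a \<in> K \<Longrightarrow> rat_eval \<phi> a \<in> D"
  by (auto simp: Int_R_def)

lemma Int_rational: "\<phi> \<in> I \<Longrightarrow> \<phi> \<in> rational_functions K"
  by (simp add: Int_R_def)

lemma Int_mult:
  assumes "\<phi> \<in> I" "\<psi> \<in> I" shows "\<phi> * \<psi> \<in> I"
  using assms by (simp add: Int_R_def rat_eval_mult D_mult rational_functions_mult)

lemma IntI_ge_1:
  assumes "\<phi> \<in> rational_functions K"
    and "\<And>a. a \<in> K \<Longrightarrow> rat_defined_at \<phi> a \<and> rat_eval \<phi> a \<in> K \<and> 1 \<le> mval (rat_eval \<phi> a)"
  shows "\<phi> \<in> I"
  using assms mval_ge_1_D by (auto simp: Int_R_def)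

lemma const_fun_Int: "d \<in> D \<Longrightarrow> const_fun d \<in> I"
  using D_subset_K rational_functions_const by (auto simp: Int_R_def rat_eval_const_fun)

text \<open>\<open>mval_poly_generic\<close> is applied to the translates by \<open>a\<close> of a
  numerator and a denominator, and \<open>F\<close> is the difference. The fraction is chosen with
  denominator nonzero at \<open>a\<close>, so that \<open>F\<close> tends to the value at
  \<open>a\<close>.\<close>

lemma generic_value:
  assumes \<phi>: "\<phi> \<in> I" "\<phi> \<noteq> 0" and a: "a \<in> K"
  obtains F E where "continuous_on UNIV F" "finite E"
    "((\<lambda>g. ereal (F g)) \<longlongrightarrow> mval (rat_eval \<phi> a)) at_top"
    "\<And>y g. y \<in> K \<Longrightarrow> mval y = ereal g \<Longrightarrow> g \<notin> E \<Longrightarrow> mval (rat_eval \<phi> (a + y)) = ereal (F g)"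
proof -
  obtain p q where pq: "\<phi> = Fract p q" "poly q a \<noteq> 0"
    using Int_defined[OF \<phi>(1) a] unfolding rat_defined_at_def by blast
  define p' where "p' = pcompose p [:a, 1:]"
  define q' where "q' = pcompose q [:a, 1:]"
  have poly: "poly p' y = poly p (a + y)" "poly q' y = poly q (a + y)" for y
    by (simp_all add: p'_def q'_def poly_pcompose)
  have "p \<noteq> 0" "q \<noteq> 0" using pq \<phi>(2) by (auto simp: fract_collapse)
  then have "p' \<noteq> 0" "q' \<noteq> 0" by (simp_all add: p'_def q'_def pcompose_eq_0_iff)
  obtain N E where N: "continuous_on UNIV N" "finite E" "((\<lambda>g. ereal (N g)) \<longlongrightarrow> mval (poly p' 0)) at_top"
     "\<forall>y g. mval y = ereal g \<longrightarrow> g \<notin> E \<longrightarrow> mval (poly p' y) = ereal (N g)"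
    using mval_poly_generic[OF \<open>p' \<noteq> 0\<close>] by blast
  obtain N' E' where N': "continuous_on UNIV N'" "finite E'" "((\<lambda>g. ereal (N' g)) \<longlongrightarrow> mval (poly q' 0)) at_top"
     "\<forall>y g. mval y = ereal g \<longrightarrow> g \<notin> E' \<longrightarrow> mval (poly q' y) = ereal (N' g)"
    using mval_poly_generic[OF \<open>q' \<noteq> 0\<close>] by blast
  have q0: "poly q' 0 \<noteq> 0" using pq by (simp add: poly)
  then obtain r where r: "mval (poly q' 0) = ereal r" by (rule mval_finite)
  show ?thesis
  proof (rule that)
    show "continuous_on UNIV (\<lambda>g. N g - N' g)" using N N' by (intro continuous_intros)
    show "finite (E \<union> E')" using N N' by simp
    have N'r: "(N' \<longlongrightarrow> r) at_top" using N'(3) r by simp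
    have "((\<lambda>g. ereal (N g - N' g)) \<longlongrightarrow> mval (poly p' 0) - mval (poly q' 0)) at_top"
    \<comment> \<open>At a zero of \<open>\<phi>\<close> the limit is infinite, so divergence
      replaces the difference of real limits.\<close>
    proof (cases "poly p' 0 = 0")
      case True
      then have "filterlim N at_top at_top"
        using N(3) by (simp add: tendsto_PInfty filterlim_at_top_dense)
      then have "filterlim (\<lambda>g. - N' g + N g) at_top at_top"
        by (rule filterlim_tendsto_add_at_top[OF tendsto_minus[OF N'r]])
      then show ?thesis using True r by (simp add: tendsto_PInfty filterlim_at_top_dense)
    next
      case False
      then obtain s where s: "mval (poly p' 0) = ereal s" by (rule mval_finite)
      then have "((\<lambda>g. N g - N' g) \<longlongrightarrow> s - r) at_top" using N(3) N'r by (intro tendsto_diff) simp_all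
      then show ?thesis using r s by simp
    qed
    moreover have "mval (poly p' 0) - mval (poly q' 0) = mval (rat_eval \<phi> a)"
      using pq q0 by (simp add: poly rat_eval_Fract mval_divide)
    ultimately show "((\<lambda>g. ereal (N g - N' g)) \<longlongrightarrow> mval (rat_eval \<phi> a)) at_top" by simp
    fix y g assume *: "y \<in> K" "mval y = ereal g" "g \<notin> E \<union> E'"
    then have v: "mval (poly p (a + y)) = ereal (N g)" "mval (poly q (a + y)) = ereal (N' g)"
      using N(4) N'(4) by (auto simp flip: poly)
    then have "poly q (a + y) \<noteq> 0" by auto
    then show "mval (rat_eval \<phi> (a + y)) = ereal (N g - N' g)"
      using v pq by (simp add: rat_eval_Fract mval_divide)
  qed
qed

section \<open>The dichotomy between values 0 and at least 1\<close>

lemma \<Gamma>_dense_avoiding: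
  assumes "x < y" "finite E" shows "\<exists>g\<in>\<Gamma>. x < g \<and> g < y \<and> g \<notin> E"
proof -
  have "infinite (\<Gamma> \<inter> {x<..<y} - E)" using \<Gamma>_dense[OF assms(1)] assms(2) by simp
  then have "\<Gamma> \<inter> {x<..<y} - E \<noteq> {}" by (rule infinite_imp_nonempty)
  then show ?thesis by auto
qed

text \<open>The number \<open>1 / 2\<close> represents the gap between 0 and 1. By continuity
  \<open>F\<close> would stay in the gap near \<open>g\<close>, but every neighbourhood contains
  points of \<open>\<Gamma>\<close> outside \<open>E\<close>.\<close>

lemma continuous_avoids_half:
  assumes F: "continuous_on UNIV F" "finite E"
    and gap: "\<And>g. g \<in> \<Gamma> \<Longrightarrow> g \<notin> E \<Longrightarrow> F g = 0 \<or> 1 \<le> F g"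
  shows "F g \<noteq> (1 / 2 :: real)"
proof
  assume "F g = 1 / 2"
  moreover have "F \<midarrow>g\<rightarrow> F g" using F(1) by (simp add: continuous_on_eq_continuous_at isCont_def)
  ultimately have "\<forall>\<^sub>F x in at g. 0 < F x \<and> F x < 1"
    by (auto intro!: eventually_conj elim: order_tendstoD)
  then obtain d where d: "0 < d" "\<And>x. x \<noteq> g \<Longrightarrow> \<bar>x - g\<bar> < d \<Longrightarrow> 0 < F x \<and> F x < 1"
    by (auto simp: eventually_at dist_real_def)
  obtain x where "x \<in> \<Gamma>" "x \<notin> E" "g < x" "x < g + d"
    using \<Gamma>_dense_avoiding[of g "g + d" E] d F(2) by auto
  then show False using gap[of x] d(2)[of x] by auto
qed

lemma avoids_half_cases:
  fixes F :: "real \<Rightarrow> real"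
  assumes "continuous_on UNIV F" "\<And>g. F g \<noteq> (1 / 2 :: real)"
  shows "(\<forall>g. F g < 1 / 2) \<or> (\<forall>g. 1 / 2 < F g)"
proof (rule ccontr)
  assume "\<not> ?thesis"
  then obtain x y where xy: "F x < 1 / 2" "1 / 2 < F y" using assms(2) by (meson linorder_neqE)
  have "connected (range F)" using assms(1) by (intro connected_continuous_image) auto
  then have "1 / 2 \<in> range F"
    using xy connectedD_interval[of "range F" "F x" "F y" "1 / 2"] by auto
  then show False using assms(2) by (metis rangeE)
qed

text \<open>
  Since \<open>\<Gamma>\<close> is dense, the continuous function \<open>F\<close> giving the generic value of \<open>\<phi>\<close> on spheres around a
  point cannot cross from \<open>0\<close> to \<open>[1, \<infinity>)\<close>; it tends to \<open>v(\<phi>(a))\<close> for shrinking spheres, and large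
  spheres around any two points coincide.
\<close>

lemma Int_value_cases:
  assumes \<phi>: "\<phi> \<in> I" "\<phi> \<noteq> 0"
  shows "(\<forall>a\<in>K. mval (rat_eval \<phi> a) = 0) \<or> (\<forall>a\<in>K. 1 \<le> mval (rat_eval \<phi> a))"
proof -
  have cases: "mval (rat_eval \<phi> a) = 0 \<or> 1 \<le> mval (rat_eval \<phi> a)" if "a \<in> K" for a
    using D_cases Int_eval[OF \<phi>(1) that] by blast
  have False if ab: "a \<in> K" "b \<in> K" and a0: "mval (rat_eval \<phi> a) = 0" and b1: "1 \<le> mval (rat_eval \<phi> b)" for a b
  proof -
    obtain F E where F: "continuous_on UNIV F" "finite E"
      "((\<lambda>g. ereal (F g)) \<longlongrightarrow> mval (rat_eval \<phi> a)) at_top"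
      "\<And>y g. y \<in> K \<Longrightarrow> mval y = ereal g \<Longrightarrow> g \<notin> E \<Longrightarrow> mval (rat_eval \<phi> (a + y)) = ereal (F g)"
      using generic_value[OF \<phi> ab(1)] by blast
    obtain G E' where G: "continuous_on UNIV G" "finite E'"
      "((\<lambda>g. ereal (G g)) \<longlongrightarrow> mval (rat_eval \<phi> b)) at_top"
      "\<And>y g. y \<in> K \<Longrightarrow> mval y = ereal g \<Longrightarrow> g \<notin> E' \<Longrightarrow> mval (rat_eval \<phi> (b + y)) = ereal (G g)"
      using generic_value[OF \<phi> ab(2)] by blast
    have gapF: "F g = 0 \<or> 1 \<le> F g" if "g \<in> \<Gamma>" "g \<notin> E" for g
      using cases[OF K_add[OF ab(1) tpow_K[OF that(1)]]] F(4)[OF tpow_K[OF that(1)]] that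
      by (simp add: zero_ereal_def one_ereal_def)
    have gapG: "G g = 0 \<or> 1 \<le> G g" if "g \<in> \<Gamma>" "g \<notin> E'" for g
      using cases[OF K_add[OF ab(2) tpow_K[OF that(1)]]] G(4)[OF tpow_K[OF that(1)]] that
      by (simp add: zero_ereal_def one_ereal_def)
    have "\<forall>\<^sub>F g in at_top. ereal (F g) < ereal (1 / 2)"
      using F(3) a0 by (intro order_tendstoD(2)) (auto simp: zero_ereal_def)
    then obtain g1 where g1: "F g1 < 1 / 2" by (auto simp: eventually_at_top_linorder)
    have "ereal (1 / 2) < mval (rat_eval \<phi> b)"
      using b1 by (rule less_le_trans[rotated]) (simp add: one_ereal_def)
    then have "\<forall>\<^sub>F g in at_top. ereal (1 / 2) < ereal (G g)"
      by (rule order_tendstoD(1)[OF G(3)])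
    then obtain g2 where g2: "1 / 2 < G g2" by (auto simp: eventually_at_top_linorder)
    \<comment> \<open>One value on a side of \<open>1 / 2\<close> fixes the side for the entire
      line, so \<open>F\<close> and \<open>G\<close> are separated everywhere.\<close>
    have Flt: "F g < 1 / 2" and Ggt: "1 / 2 < G g" for g
      using avoids_half_cases[OF F(1)] continuous_avoids_half[OF F(1,2) gapF] g1
        avoids_half_cases[OF G(1)] continuous_avoids_half[OF G(1,2) gapG] g2 by (meson less_asym)+
    \<comment> \<open>For \<open>g\<close> below the value of \<open>a - b\<close>, the point
      \<open>a + t^g\<close>, which is also \<open>b + (t^g + (a - b))\<close>, lies on the spheres
      of value \<open>g\<close> around both \<open>a\<close> and \<open>b\<close>. There
      \<open>F\<close> and \<open>G\<close> must agree.\<close>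
    obtain B where B: "ereal B \<le> mval (a - b)"
      by (metis ereal_less_eq(1) mval_0 mval_finite order_refl)
    obtain g where g: "g \<in> \<Gamma>" "g \<notin> E" "g \<notin> E'" "g < B"
      using \<Gamma>_dense_avoiding[of "B - 1" B "E \<union> E'"] F(2) G(2) by auto
    have "ereal g < mval (a - b)" using g(4) B by (metis less_ereal.simps(1) less_le_trans)
    then have "mval (tpow g + (a - b)) = ereal g" using mval_add_eq[of "tpow g" "a - b"] by simp
    then have "mval (rat_eval \<phi> (b + (tpow g + (a - b)))) = ereal (G g)"
      using G(4) tpow_K[OF g(1)] K_add K_diff ab g by blast
    moreover have "mval (rat_eval \<phi> (a + tpow g)) = ereal (F g)" using F(4) tpow_K g by simp
    ultimately have "F g = G g" by (simp add: algebra_simps)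
    then show False using Flt[of g] Ggt[of g] by simp
  qed
  then show ?thesis using cases by blast
qed

lemma Int_nonzero_eval:
  assumes "\<phi> \<in> I" "\<phi> \<noteq> 0" shows "\<exists>a\<in>K. rat_eval \<phi> a \<noteq> 0"
proof -
  obtain p q where pq: "\<phi> = Fract p q" "q \<noteq> 0"
    using Int_rational[OF assms(1)] unfolding rational_functions_def by blast
  then have "p \<noteq> 0" using assms by (auto simp: fract_collapse)
  then have "finite {x. poly (p * q) x = 0}" using pq by (intro poly_roots_finite) simp
  then obtain a where "a \<in> K" "poly (p * q) a \<noteq> 0"
    using K_infinite by (metis (mono_tags, lifting) finite_subset mem_Collect_eq subsetI)
  then show ?thesis using pq by (intro bexI[of _ a]) (auto simp: rat_eval_Fract)
qed

text \<open>The values of \<open>\<phi>\<close> and its inverse add up to 0 and are nonnegative, so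
  both vanish. Conversely, elements of \<open>D\<close> of value 0 are invertible in
  \<open>D\<close>, by \<open>D_cases\<close>.\<close>

lemma Int_inverse_iff:
  assumes \<phi>: "\<phi> \<in> I" "\<phi> \<noteq> 0"
  shows "inverse \<phi> \<in> I \<longleftrightarrow> (\<forall>a\<in>K. mval (rat_eval \<phi> a) = 0)"
proof
  assume inv: "inverse \<phi> \<in> I"
  show "\<forall>a\<in>K. mval (rat_eval \<phi> a) = 0"
  proof
    fix a assume a: "a \<in> K"
    have "rat_eval \<phi> a * rat_eval (inverse \<phi>) a = rat_eval (\<phi> * inverse \<phi>) a"
      using rat_eval_mult(2) Int_defined \<phi> inv a by metis
    also have "\<dots> = rat_eval (const_fun 1) a" using \<phi> by simp
    also have "\<dots> = 1" by (rule rat_eval_const_fun)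
    finally have "mval (rat_eval \<phi> a) + mval (rat_eval (inverse \<phi>) a) = 0"
      by (metis mval_mult mval_one)
    moreover have "mval (rat_eval \<phi> a) = 0 \<or> 1 \<le> mval (rat_eval \<phi> a)"
      "mval (rat_eval (inverse \<phi>) a) = 0 \<or> 1 \<le> mval (rat_eval (inverse \<phi>) a)"
      using D_cases Int_eval a \<phi> inv by blast+
    ultimately show "mval (rat_eval \<phi> a) = 0"
      by (cases "mval (rat_eval \<phi> a)"; cases "mval (rat_eval (inverse \<phi>) a)")
        (auto simp: zero_ereal_def one_ereal_def)
  qed
next
  assume v: "\<forall>a\<in>K. mval (rat_eval \<phi> a) = 0"
  have "rat_defined_at (inverse \<phi>) a \<and> rat_eval (inverse \<phi>) a \<in> D" if a: "a \<in> K" for a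
  proof -
    have nz: "rat_eval \<phi> a \<noteq> 0" using v a by force
    have "inverse (rat_eval \<phi> a) \<in> D" using D_cases[OF Int_eval[OF \<phi>(1) a]] v a by auto
    then show ?thesis using rat_eval_inverse[OF Int_defined[OF \<phi>(1) a] nz] by simp
  qed
  then show "inverse \<phi> \<in> I"
    using rational_functions_inverse[OF Int_rational[OF \<phi>(1)]] by (simp add: Int_R_def)
qed

section \<open>The infimum of the values\<close>

definition "\<alpha> \<phi> = real_of_ereal (min_val K \<phi>)"

text \<open>All values are nonnegative and at least one is finite, so passing to a real number loses
  nothing.\<close>

lemma min_val_eq:
  assumes "\<phi> \<in> I" "\<phi> \<noteq> 0" shows "min_val K \<phi> = ereal (\<alpha> \<phi>)"
proof -
  obtain a where "a \<in> K" "rat_eval \<phi> a \<noteq> 0" using Int_nonzero_eval assms by blast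
  then have "min_val K \<phi> \<le> mval (rat_eval \<phi> a)" "mval (rat_eval \<phi> a) \<noteq> \<infinity>"
    unfolding min_val_def by (auto intro: INF_lower)
  moreover have "0 \<le> mval (rat_eval \<phi> a)" if "a \<in> K" for a
  proof -
    have "mval (rat_eval \<phi> a) = 0 \<or> 1 \<le> mval (rat_eval \<phi> a)" using Int_value_cases[OF assms] that by blast
    then show ?thesis using order_trans[of 0 1 "mval (rat_eval \<phi> a)"] by auto
  qed
  then have "0 \<le> min_val K \<phi>" unfolding min_val_def by (rule INF_greatest)
  ultimately show ?thesis unfolding \<alpha>_def by (cases "min_val K \<phi>") auto
qed

lemma \<alpha>_le: "\<phi> \<in> I \<Longrightarrow> \<phi> \<noteq> 0 \<Longrightarrow> a \<in> K \<Longrightarrow> ereal (\<alpha> \<phi>) \<le> mval (rat_eval \<phi> a)"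
  unfolding min_val_eq[symmetric] min_val_def by (rule INF_lower)

lemma \<alpha>_greatest:
  assumes "\<phi> \<in> I" "\<phi> \<noteq> 0" "\<And>a. a \<in> K \<Longrightarrow> ereal r \<le> mval (rat_eval \<phi> a)" shows "r \<le> \<alpha> \<phi>"
proof -
  have "ereal r \<le> min_val K \<phi>" unfolding min_val_def by (rule INF_greatest) (rule assms(3))
  then show ?thesis using min_val_eq[OF assms(1,2)] by simp
qed

lemma \<alpha>_approx:
  assumes "\<phi> \<in> I" "\<phi> \<noteq> 0" "\<alpha> \<phi> < s" shows "\<exists>a\<in>K. mval (rat_eval \<phi> a) < ereal s"
proof -
  have "min_val K \<phi> < ereal s" using min_val_eq[OF assms(1,2)] assms(3) by simp
  then show ?thesis unfolding min_val_def by (simp add: INF_less_iff)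
qed

lemma \<alpha>_const:
  assumes "d \<in> D" "d \<noteq> 0" shows "mval d = ereal (\<alpha> (const_fun d))"
proof -
  have "K \<noteq> {}" using K_0 by blast
  then have "min_val K (const_fun d) = mval d" by (simp add: min_val_def rat_eval_const_fun)
  moreover have "const_fun d \<noteq> 0" using assms(2) const_fun_inject[of d 0] by simp
  ultimately show ?thesis using min_val_eq const_fun_Int assms by metis
qed

lemma \<alpha>_unit: "\<phi> \<in> I \<Longrightarrow> \<phi> \<noteq> 0 \<Longrightarrow> inverse \<phi> \<in> I \<Longrightarrow> \<alpha> \<phi> = 0"
proof -
  assume *: "\<phi> \<in> I" "\<phi> \<noteq> 0" "inverse \<phi> \<in> I"
  then have v: "\<forall>a\<in>K. mval (rat_eval \<phi> a) = 0" using Int_inverse_iff by blast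
  then have "\<alpha> \<phi> \<le> 0" using \<alpha>_le[OF *(1,2) K_0] K_0 by (simp add: zero_ereal_def)
  moreover have "0 \<le> \<alpha> \<phi>" using v by (intro \<alpha>_greatest *) (simp add: zero_ereal_def)
  ultimately show "\<alpha> \<phi> = 0" by simp
qed

lemma \<alpha>_nonunit: "\<phi> \<in> I \<Longrightarrow> \<phi> \<noteq> 0 \<Longrightarrow> inverse \<phi> \<notin> I \<Longrightarrow> 1 \<le> \<alpha> \<phi>"
  using Int_inverse_iff Int_value_cases by (intro \<alpha>_greatest) (auto simp: one_ereal_def)

lemma \<alpha>_mult:
  assumes "\<phi> \<in> I" "\<psi> \<in> I" "\<phi> \<noteq> 0" "\<psi> \<noteq> 0" shows "\<alpha> \<phi> + \<alpha> \<psi> \<le> \<alpha> (\<phi> * \<psi>)"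
proof (rule \<alpha>_greatest)
  fix a assume a: "a \<in> K"
  have "ereal (\<alpha> \<phi>) + ereal (\<alpha> \<psi>) \<le> mval (rat_eval \<phi> a) + mval (rat_eval \<psi> a)"
    using \<alpha>_le assms a by (intro add_mono) auto
  then show "ereal (\<alpha> \<phi> + \<alpha> \<psi>) \<le> mval (rat_eval (\<phi> * \<psi>) a)"
    using rat_eval_mult(2)[of \<phi> a \<psi>] Int_defined[OF _ a] assms by (simp add: mval_mult)
qed (use assms Int_mult in auto)

text \<open>Elements of \<open>K\<close> of value at least 1 lie in \<open>D\<close>, so
  divisibility can be read off the values once they differ by at least 1 everywhere.\<close>

lemma quotient_Int:
  assumes \<phi>: "\<phi> \<in> I" "\<phi> \<noteq> 0" and \<psi>: "\<psi> \<in> I"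
    and nz: "\<And>a. a \<in> K \<Longrightarrow> rat_eval \<psi> a \<noteq> 0"
    and ge: "\<And>a. a \<in> K \<Longrightarrow> 1 \<le> mval (rat_eval \<phi> a) - mval (rat_eval \<psi> a)"
  shows "\<phi> / \<psi> \<in> I" "\<And>a. a \<in> K \<Longrightarrow> mval (rat_eval (\<phi> / \<psi>) a) = mval (rat_eval \<phi> a) - mval (rat_eval \<psi> a)"
proof -
  have ev: "rat_defined_at (\<phi> / \<psi>) a \<and> rat_eval (\<phi> / \<psi>) a = rat_eval \<phi> a / rat_eval \<psi> a" if a: "a \<in> K" for a
    using rat_eval_mult[of \<phi> a "inverse \<psi>"] rat_eval_inverse[of \<psi> a]
      Int_defined[OF \<phi>(1) a] Int_defined[OF \<psi> a] nz[OF a]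
    by (simp add: divide_inverse)
  then show v: "mval (rat_eval (\<phi> / \<psi>) a) = mval (rat_eval \<phi> a) - mval (rat_eval \<psi> a)" if "a \<in> K" for a
    using that nz by (simp add: mval_divide)
  show "\<phi> / \<psi> \<in> I"
  proof (rule IntI_ge_1)
    show "\<phi> / \<psi> \<in> rational_functions K"
      using rational_functions_mult[OF Int_rational[OF \<phi>(1)] rational_functions_inverse[OF Int_rational[OF \<psi>]]]
      by (simp add: divide_inverse)
    fix a assume a: "a \<in> K"
    have "rat_eval \<phi> a / rat_eval \<psi> a \<in> K"
      using K_divide D_subset_K Int_eval \<phi> \<psi> a by blast
    then show "rat_defined_at (\<phi> / \<psi>) a \<and> rat_eval (\<phi> / \<psi>) a \<in> K \<and> 1 \<le> mval (rat_eval (\<phi> / \<psi>) a)"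
      using ev[OF a] v[OF a] ge[OF a] by simp
  qed
qed

section \<open>Constants of value one\<close>

definition "T = {const_fun (tpow 1 * (1 + tpow \<epsilon>) :: (real \<Rightarrow>\<^sub>0 'k) fract) | \<epsilon>. \<epsilon> \<in> \<Gamma> \<and> 0 < \<epsilon> \<and> \<epsilon> < 1}"

lemma mval_one_add_tpow: "0 < \<epsilon> \<Longrightarrow> mval (1 + tpow \<epsilon> :: (real \<Rightarrow>\<^sub>0 'k) fract) = 0"
  using mval_add_eq[of 1 "tpow \<epsilon>"] by (simp add: zero_ereal_def)

lemma T_cases:
  assumes "t \<in> T"
  obtains d where "t = const_fun d" "d \<in> D" "mval d = 1"
proof -
  obtain \<epsilon> where \<epsilon>: "\<epsilon> \<in> \<Gamma>" "0 < \<epsilon>" "t = const_fun (tpow 1 * (1 + tpow \<epsilon>))" using assms by (auto simp: T_def)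
  then have v: "mval (tpow 1 * (1 + tpow \<epsilon>) :: (real \<Rightarrow>\<^sub>0 'k) fract) = 1"
    by (simp add: mval_mult mval_one_add_tpow one_ereal_def)
  have "(tpow 1 * (1 + tpow \<epsilon>) :: (real \<Rightarrow>\<^sub>0 'k) fract) \<in> D"
    by (rule mval_ge_1_D) (use v \<epsilon> one in \<open>auto intro!: K_mult K_add tpow_K K_1\<close>)
  then show ?thesis using that \<epsilon> v by blast
qed

lemma T_Int:
  assumes "t \<in> T" shows "t \<in> I \<and> t \<noteq> 0"
proof -
  obtain d where d: "t = const_fun d" "d \<in> D" "mval d = 1" using assms by (rule T_cases)
  then have "d \<noteq> 0" by auto
  then show ?thesis using d const_fun_Int const_fun_inject[of d 0] by simp
qed

lemma tpow_inject: "tpow a = (tpow b :: (real \<Rightarrow>\<^sub>0 'k) fract) \<longleftrightarrow> a = b"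
  by (metis mval_tpow ereal.inject)

lemma T_infinite: "infinite T"
proof -
  have "T = (\<lambda>\<epsilon>. const_fun (tpow 1 * (1 + tpow \<epsilon>))) ` (\<Gamma> \<inter> {0<..<1})" by (auto simp: T_def)
  moreover have "inj (\<lambda>\<epsilon>. const_fun (tpow 1 * (1 + tpow \<epsilon>) :: (real \<Rightarrow>\<^sub>0 'k) fract))"
    by (auto simp: inj_def tpow_inject)
  ultimately show ?thesis using \<Gamma>_dense[of 0 1] by (simp add: finite_image_iff inj_on_subset)
qed

text \<open>The quotient minus 1 would be an element of \<open>D\<close> whose value is the smaller
  of the two exponents, strictly between 0 and 1.\<close>

lemma T_distinct:
  assumes "s \<in> T" "t \<in> T" "s \<noteq> t" shows "s / t \<notin> I"
proof
  assume st: "s / t \<in> I"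
  obtain \<delta> \<epsilon> where \<epsilon>: "0 < \<delta>" "\<delta> < 1" "s = const_fun (tpow 1 * (1 + tpow \<delta>))"
      "0 < \<epsilon>" "\<epsilon> < 1" "t = const_fun (tpow 1 * (1 + tpow \<epsilon>))"
    using assms by (auto simp: T_def)
  have ne: "\<delta> \<noteq> \<epsilon>" using assms \<epsilon> by auto
  let ?x = "(1 + tpow \<delta>) / (1 + tpow \<epsilon>) :: (real \<Rightarrow>\<^sub>0 'k) fract"
  have nz: "1 + tpow \<epsilon> \<noteq> (0 :: (real \<Rightarrow>\<^sub>0 'k) fract)" using mval_one_add_tpow[OF \<epsilon>(4)] by force
  have "s / t = const_fun (tpow 1 * (1 + tpow \<delta>) / (tpow 1 * (1 + tpow \<epsilon>)))"
    unfolding \<epsilon> divide_inverse const_fun_inverse const_fun_mult ..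
  also have "\<dots> = const_fun ?x" by simp
  finally have "s / t = const_fun ?x" .
  then have "?x \<in> D" using Int_eval[OF st K_0] by (simp add: rat_eval_const_fun)
  then have "?x - 1 \<in> D" by (rule D_diff_1)
  moreover have "?x - 1 = (tpow \<delta> - tpow \<epsilon>) / (1 + tpow \<epsilon>)" using nz by (simp add: field_simps)
  moreover have "mval (tpow \<delta> - tpow \<epsilon> :: (real \<Rightarrow>\<^sub>0 'k) fract) = ereal (min \<delta> \<epsilon>)"
    using mval_add_neq[of "tpow \<delta> :: (real \<Rightarrow>\<^sub>0 'k) fract" "- tpow \<epsilon>"] ne by (simp add: min_def)
  ultimately have "mval (?x - 1) = ereal (min \<delta> \<epsilon>)"
    using nz mval_one_add_tpow[OF \<epsilon>(4)] by (simp add: mval_divide)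
  then show False using D_cases[OF \<open>?x - 1 \<in> D\<close>] \<epsilon>
    by (auto simp: zero_ereal_def one_ereal_def min_def split: if_splits)
qed

lemma T_value:
  assumes "t \<in> T" shows "\<alpha> t = 1"
proof -
  obtain d where d: "t = const_fun d" "d \<in> D" "mval d = 1" using assms by (rule T_cases)
  then have "d \<noteq> 0" by auto
  then show ?thesis using \<alpha>_const[of d] d by (simp add: one_ereal_def)
qed

text \<open>Division by a constant of value 1 lowers each value by exactly 1, and values of at least
  2 remain at least 1.\<close>

lemma T_divides:
  assumes t: "t \<in> T" and \<phi>: "\<phi> \<in> I" "\<phi> \<noteq> 0" "2 \<le> \<alpha> \<phi>"
  shows "\<phi> / t \<in> I \<and> \<alpha> \<phi> - 1 \<le> \<alpha> (\<phi> / t)"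
proof -
  obtain d where d: "t = const_fun d" "d \<in> D" "mval d = 1" using t by (rule T_cases)
  have "d \<noteq> 0" using d by auto
  have ge: "ereal (\<alpha> \<phi> - 1) \<le> mval (rat_eval \<phi> a) - mval (rat_eval t a)" if "a \<in> K" for a
    using \<alpha>_le[OF \<phi>(1,2) that] d
    by (cases "mval (rat_eval \<phi> a)") (auto simp: rat_eval_const_fun one_ereal_def)
  have ge1: "1 \<le> mval (rat_eval \<phi> a) - mval (rat_eval t a)" if "a \<in> K" for a
    by (rule order_trans[OF _ ge[OF that]]) (use \<phi>(3) in \<open>simp add: one_ereal_def\<close>)
  note q = quotient_Int[OF \<phi>(1,2), of t, OF _ _ ge1]
  have "t \<in> I" "\<And>a. a \<in> K \<Longrightarrow> rat_eval t a \<noteq> 0" using d const_fun_Int \<open>d \<noteq> 0\<close> by (auto simp: rat_eval_const_fun)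
  then show ?thesis using q ge T_Int[OF t] \<phi> by (auto intro!: \<alpha>_greatest)
qed

section \<open>Splitting an integer-valued function\<close>

lemma truncation_polynomial:
  assumes "\<not> (\<forall>p :: 'k poly. Polynomial.degree p > 0 \<longrightarrow> (\<exists>x. poly p x = 0))
      \<or> \<not> divisible_set (gp M)"
  obtains P n \<gamma> where "P \<in> Kpoly" "0 < n"
    "\<And>y. y \<in> K \<Longrightarrow> mval (poly P y) = min (ereal (real n) * mval y) (ereal \<gamma>)"
  using assms
proof (elim disjE)
  assume "\<not> (\<forall>p :: 'k poly. Polynomial.degree p > 0 \<longrightarrow> (\<exists>x. poly p x = 0))"
  \<comment> \<open>A polynomial without roots in \<open>k\<close> gives the truncation at
    0.\<close>
  then obtain p :: "'k poly" where p: "degree p > 0" "\<And>x. poly p x \<noteq> 0" by blast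
  show thesis
  proof (rule that)
    show "map_poly const_fract p \<in> Kpoly"
      by (simp add: Kpoly_def coeff_map_poly const_fract_hom const_fract_K)
    show "0 < degree p" by (rule p)
    show "mval (poly (map_poly const_fract p) y) = min (ereal (real (degree p)) * mval y) (ereal 0)" for y
      using rootless_poly_mval[OF p] by (simp add: zero_ereal_def)
  qed
next
  assume "\<not> divisible_set (gp M)"
  \<comment> \<open>Since \<open>\<gamma>\<close> is not \<open>n\<close> times an element of
    \<open>\<Gamma>\<close>, the two terms of \<open>y^n + t^\<gamma>\<close> never have equal
    value, and no cancellation occurs.\<close>
  then obtain n \<gamma> where n: "0 < n" "\<gamma> \<in> \<Gamma>" "\<And>\<delta>. \<delta> \<in> \<Gamma> \<Longrightarrow> real n * \<delta> \<noteq> \<gamma>"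
    unfolding divisible_set_def gp_M by blast
  show thesis
  proof (rule that)
    show "monom 1 n + [:tpow \<gamma>:] \<in> Kpoly"
      using tpow_K[OF n(2)] by (intro Kpoly_add) (simp_all add: Kpoly_pCons Kpoly_0, simp add: Kpoly_def K_0 K_1)
    show "0 < n" by (rule n)
    fix y assume y: "y \<in> K"
    show "mval (poly (monom 1 n + [:tpow \<gamma>:]) y) = min (ereal (real n) * mval y) (ereal \<gamma>)"
    proof (cases "y = 0")
      case True
      then show ?thesis using n(1) by (simp add: poly_monom power_0_left)
    next
      case False
      then obtain g where g: "g \<in> \<Gamma>" "mval y = ereal g" using mval_K y by blast
      then have v: "mval (y ^ n) = ereal (real n * g)" by (simp add: mval_power)
      then have "mval (y ^ n + tpow \<gamma>) = min (ereal (real n * g)) (ereal \<gamma>)"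
        using mval_add_neq[of "y ^ n" "tpow \<gamma>"] n(3)[OF g(1)] by simp
      then show ?thesis using g by (simp add: poly_monom)
    qed
  qed
qed

text \<open>
  If \<open>v(P(y)) = min(n v(y), \<gamma>)\<close>, then \<open>t\<^sup>n\<^sup>c P((x - a)/t\<^sup>c) / P(x - a)\<close> has value
  \<open>min(n v(x - a), \<gamma> + nc) - min(n v(x - a), \<gamma>)\<close>, which ranges from \<open>0\<close> to \<open>nc\<close>.
\<close>

lemma step_function:
  assumes P: "P \<in> Kpoly" "0 < n"
    "\<And>y. y \<in> K \<Longrightarrow> mval (poly P y) = min (ereal (real n) * mval y) (ereal \<gamma>)"
    and a: "a \<in> K" and c: "c \<in> \<Gamma>" "0 \<le> c"
  obtains \<theta> where "\<theta> \<in> rational_functions K"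
    "\<And>x. x \<in> K \<Longrightarrow> rat_defined_at \<theta> x \<and> rat_eval \<theta> x \<in> K"
    "\<And>x. x \<in> K \<Longrightarrow> \<exists>r. mval (rat_eval \<theta> x) = ereal r \<and> 0 \<le> r \<and> r \<le> real n * c"
    "mval (rat_eval \<theta> a) = ereal (real n * c)" "\<exists>b\<in>K. mval (rat_eval \<theta> b) = 0"
proof -
  define s :: "(real \<Rightarrow>\<^sub>0 'k) fract" where "s = tpow (- c)"
  define p where "p = smult (tpow (real n * c)) (pcompose P [:- a * s, s:])"
  define q where "q = pcompose P [:- a, 1:]"
  have nc: "real n * c \<in> \<Gamma>" "0 \<le> real n * c" using \<Gamma>_mult_nat c by auto
  have sK: "s \<in> K" unfolding s_def using tpow_K \<Gamma>_uminus c by blast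
  have pq: "p \<in> Kpoly" "q \<in> Kpoly" unfolding p_def q_def using P(1) sK a tpow_K[OF nc(1)]
    by (auto intro!: Kpoly_smult Kpoly_pcompose simp: Kpoly_pCons Kpoly_0 K_1 K_uminus K_mult)
  have poly_p: "poly p x = tpow (real n * c) * poly P ((x - a) * s)" for x
    by (simp add: p_def poly_pcompose algebra_simps)
  have poly_q: "poly q x = poly P (x - a)" for x
    by (simp add: q_def poly_pcompose)
  have vq: "mval (poly q x) = min (ereal (real n) * mval (x - a)) (ereal \<gamma>)" if "x \<in> K" for x
    unfolding poly_q using P(3) K_diff that a by blast
  have vp: "mval (poly p x) = ereal (real n * c) + min (ereal (real n) * (mval (x - a) + ereal (- c))) (ereal \<gamma>)"
    if "x \<in> K" for x
    unfolding poly_p using P(3)[OF K_mult[OF K_diff[OF that a] sK]] by (simp add: mval_mult s_def)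
  \<comment> \<open>The truncation at \<open>\<gamma>\<close> keeps the value of the denominator
    finite, so there are no poles on \<open>K\<close>.\<close>
  have q_nz: "poly q x \<noteq> 0" if "x \<in> K" for x
  proof
    assume "poly q x = 0"
    then have "min (ereal (real n) * mval (x - a)) (ereal \<gamma>) = \<infinity>" using vq[OF that] by simp
    then show False by (simp add: min_def split: if_splits)
  qed
  define \<theta> where "\<theta> = Fract p q"
  have ev: "rat_defined_at \<theta> x" "rat_eval \<theta> x = poly p x / poly q x" if "x \<in> K" for x
    using q_nz[OF that] unfolding rat_defined_at_def \<theta>_def by (blast, simp add: rat_eval_Fract)
  have value_a: "mval (rat_eval \<theta> a) = ereal (real n * c)"
    using vp[OF a] vq[OF a] ev[OF a] q_nz[OF a] P(2) by (simp add: mval_divide)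
  have value_sphere: "mval (rat_eval \<theta> x) = ereal (real n * c + min (real n * (g - c)) \<gamma> - min (real n * g) \<gamma>)"
    if "x \<in> K" "mval (x - a) = ereal g" for x g
    using vp[OF that(1)] vq[OF that(1)] ev[OF that(1)] q_nz[OF that(1)] that(2)
    by (simp add: mval_divide flip: ereal_min)
  show ?thesis
  proof (rule that)
    have "q \<noteq> 0" using q_nz[OF a] by auto
    then show "\<theta> \<in> rational_functions K" unfolding rational_functions_iff \<theta>_def using pq by blast
    show "rat_defined_at \<theta> x \<and> rat_eval \<theta> x \<in> K" if "x \<in> K" for x
      using ev[OF that] poly_Kpoly pq that K_divide by simp
    show "mval (rat_eval \<theta> a) = ereal (real n * c)" by (rule value_a)
    show "\<exists>r. mval (rat_eval \<theta> x) = ereal r \<and> 0 \<le> r \<and> r \<le> real n * c" if x: "x \<in> K" for x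
    proof (cases "x = a")
      case True
      then show ?thesis using value_a nc by auto
    next
      case False
      then obtain g where "mval (x - a) = ereal g" using mval_finite[of "x - a"] by auto
      note v = value_sphere[OF x this]
      have "real n * (g - c) = real n * g - real n * c" by (simp add: algebra_simps)
      then show ?thesis using v nc by (auto simp: min_def)
    qed
    \<comment> \<open>Far away from \<open>a\<close>, at a point of value \<open>- N\<close>
      relative to it, neither minimum is truncated and the two values cancel to 0.\<close>
    obtain N :: nat where N: "- \<gamma> \<le> real N" using real_arch_simple by blast
    have "real N \<le> real n * real N" using P(2) by (simp add: mult_le_cancel_right1)
    then have low: "real n * (- real N) \<le> \<gamma>" using N by simp
    then have low': "real n * (- real N - c) \<le> \<gamma>" using nc by (simp add: algebra_simps)
    have b: "a + tpow (- real N) \<in> K" using K_add a tpow_K \<Gamma>_uminus \<Gamma>_of_nat by blast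
    have "mval (rat_eval \<theta> (a + tpow (- real N))) = 0"
      using value_sphere[OF b, of "- real N"] low low' by (simp add: min_def algebra_simps zero_ereal_def)
    then show "\<exists>b\<in>K. mval (rat_eval \<theta> b) = 0" using b by blast
  qed
qed

text \<open>The factor \<open>\<psi>\<close> is \<open>t\<close> times a step function. It takes the
  value 1 somewhere, and its largest value \<open>1 + n c\<close> at a point \<open>a\<close> where
  \<open>\<phi>\<close> has value below \<open>n c + 3\<close>. So the quotient has value below 2 at
  \<open>a\<close>, while all its values are at least \<open>\<alpha> \<phi> - 1 - n c\<close>,
  hence at least 1.\<close>

lemma Int_split:
  assumes P: "P \<in> Kpoly" "0 < n"
    "\<And>y. y \<in> K \<Longrightarrow> mval (poly P y) = min (ereal (real n) * mval y) (ereal \<gamma>)"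
    and \<phi>: "\<phi> \<in> I" "\<phi> \<noteq> 0" "2 \<le> \<alpha> \<phi>"
  shows "\<exists>\<psi>\<in>I. \<exists>\<chi>\<in>I. \<phi> = \<psi> * \<chi> \<and> 1 \<le> \<alpha> \<psi> \<and> \<alpha> \<psi> < 2 \<and> 1 \<le> \<alpha> \<chi> \<and> \<alpha> \<chi> < 2"
proof -
  \<comment> \<open>The admissible range for \<open>n c\<close> has length 1, so density of
    \<open>\<Gamma>\<close> provides \<open>c\<close>. For values below 3 the lower end is negative,
    and \<open>c = 0\<close> is taken to keep \<open>c\<close> nonnegative.\<close>
  obtain c where c: "c \<in> \<Gamma>" "0 \<le> c" "\<alpha> \<phi> - 3 < real n * c" "real n * c \<le> \<alpha> \<phi> - 2"
  proof (cases "\<alpha> \<phi> < 3")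
    case True
    then show ?thesis using that[of 0] \<Gamma>_0 \<phi>(3) by simp
  next
    case False
    have "(\<alpha> \<phi> - 3) / real n < (\<alpha> \<phi> - 2) / real n" using P(2) by (intro divide_strict_right_mono) auto
    then obtain g where g: "g \<in> \<Gamma>" "(\<alpha> \<phi> - 3) / real n < g" "g < (\<alpha> \<phi> - 2) / real n"
      using \<Gamma>_dense_avoiding by blast
    have "0 \<le> (\<alpha> \<phi> - 3) / real n" using False by simp
    then have "0 \<le> g" using g(2) by linarith
    then show ?thesis using that[of g] g P(2) by (simp add: field_simps)
  qed
  have "\<alpha> \<phi> < real n * c + 3" using c by simp
  then obtain a where a: "a \<in> K" "mval (rat_eval \<phi> a) < ereal (real n * c + 3)"
    using \<alpha>_approx \<phi> by blast
  obtain \<theta> where \<theta>: "\<theta> \<in> rational_functions K"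
    "\<And>x. x \<in> K \<Longrightarrow> rat_defined_at \<theta> x \<and> rat_eval \<theta> x \<in> K"
    "\<And>x. x \<in> K \<Longrightarrow> \<exists>r. mval (rat_eval \<theta> x) = ereal r \<and> 0 \<le> r \<and> r \<le> real n * c"
    "mval (rat_eval \<theta> a) = ereal (real n * c)" "\<exists>b\<in>K. mval (rat_eval \<theta> b) = 0"
    using step_function[OF P a(1) c(1,2)] by blast
  define \<psi> where "\<psi> = const_fun (tpow 1) * \<theta>"
  have ev: "rat_defined_at \<psi> x" "rat_eval \<psi> x = tpow 1 * rat_eval \<theta> x" if "x \<in> K" for x
    using rat_eval_mult[of "const_fun (tpow 1)" x \<theta>] \<theta>(2)[OF that] by (simp_all add: \<psi>_def rat_eval_const_fun)
  have v: "\<exists>r. mval (rat_eval \<psi> x) = ereal r \<and> 1 \<le> r \<and> r \<le> 1 + real n * c" if x: "x \<in> K" for x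
  proof -
    obtain r where "mval (rat_eval \<theta> x) = ereal r" "0 \<le> r" "r \<le> real n * c" using \<theta>(3)[OF x] by blast
    then show ?thesis using ev[OF x] by (intro exI[of _ "1 + r"]) (simp add: mval_mult)
  qed
  have \<psi>: "\<psi> \<in> I"
  proof (rule IntI_ge_1)
    show "\<psi> \<in> rational_functions K"
      unfolding \<psi>_def using rational_functions_mult rational_functions_const tpow_K one \<theta>(1) by blast
    fix x assume x: "x \<in> K"
    show "rat_defined_at \<psi> x \<and> rat_eval \<psi> x \<in> K \<and> 1 \<le> mval (rat_eval \<psi> x)"
      using ev[OF x] v[OF x] \<theta>(2)[OF x] K_mult tpow_K one by (auto simp: one_ereal_def)
  qed
  have \<psi>nz: "rat_eval \<psi> x \<noteq> 0" if "x \<in> K" for x using v[OF that] by auto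
  have \<psi>0: "\<psi> \<noteq> 0" using \<psi>nz[OF K_0] rat_eval_const_fun(2)[of 0 0] by auto
  have ge: "ereal (\<alpha> \<phi> - 1 - real n * c) \<le> mval (rat_eval \<phi> x) - mval (rat_eval \<psi> x)" if "x \<in> K" for x
    using v[OF that] \<alpha>_le[OF \<phi>(1,2) that] by (cases "mval (rat_eval \<phi> x)") auto
  have ge1: "1 \<le> mval (rat_eval \<phi> x) - mval (rat_eval \<psi> x)" if "x \<in> K" for x
    by (rule order_trans[OF _ ge[OF that]]) (use c in \<open>simp add: one_ereal_def\<close>)
  note q = quotient_Int[OF \<phi>(1,2) \<psi> \<psi>nz ge1]
  have nz: "\<phi> / \<psi> \<noteq> 0" using \<phi> \<psi>0 by simp
  have "1 \<le> \<alpha> \<psi>" using v by (intro \<alpha>_greatest \<psi> \<psi>0) force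
  moreover have "\<alpha> \<psi> < 2"
  proof -
    obtain b where b: "b \<in> K" "mval (rat_eval \<theta> b) = 0" using \<theta>(5) by blast
    then have "mval (rat_eval \<psi> b) = ereal 1" using ev by (simp add: mval_mult)
    then show ?thesis using \<alpha>_le[OF \<psi> \<psi>0 b(1)] by simp
  qed
  moreover have "1 \<le> \<alpha> (\<phi> / \<psi>)"
    using q ge1 by (intro \<alpha>_greatest nz) (auto simp: one_ereal_def)
  moreover have "\<alpha> (\<phi> / \<psi>) < 2"
  proof -
    have "mval (rat_eval \<psi> a) = ereal (1 + real n * c)" using ev[OF a(1)] \<theta>(4) by (simp add: mval_mult)
    then have "mval (rat_eval (\<phi> / \<psi>) a) < ereal 2"
      using q(2)[OF _ _ a(1)] a(2) by (cases "mval (rat_eval \<phi> a)") auto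
    then show ?thesis using \<alpha>_le[OF q(1) nz a(1)] by (metis ereal_less_eq(3) le_less_trans less_ereal.simps(1))
  qed
  ultimately show ?thesis using q(1) \<psi> \<psi>0
    by (intro bexI[of _ \<psi>] bexI[of _ "\<phi> / \<psi>"]) auto
qed

section \<open>Conclusion for \<open>D\<close> and for integer-valued functions\<close>

lemma valued_submonoid_Int:
  assumes "\<not> (\<forall>p :: 'k poly. Polynomial.degree p > 0 \<longrightarrow> (\<exists>x. poly p x = 0))
      \<or> \<not> divisible_set (gp M)"
  shows "valued_submonoid I \<alpha> T"
proof -
  obtain P n \<gamma> where P: "P \<in> Kpoly" "0 < n"
    "\<And>y. y \<in> K \<Longrightarrow> mval (poly P y) = min (ereal (real n) * mval y) (ereal \<gamma>)"
    using truncation_polynomial[OF assms] by blast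
  have split: "\<exists>\<psi>\<in>I. \<exists>\<chi>\<in>I. \<phi> = \<psi> * \<chi> \<and> 1 \<le> \<alpha> \<psi> \<and> \<alpha> \<psi> < 2 \<and> 1 \<le> \<alpha> \<chi> \<and> \<alpha> \<chi> < 2"
    if "\<phi> \<in> I" "\<phi> \<noteq> 0" "2 \<le> \<alpha> \<phi>" for \<phi>
    using P that by (rule Int_split)
  have "1 \<in> I" using const_fun_Int[OF D_1] by simp
  then show ?thesis
    by (rule valued_submonoid.intro)
      (fact Int_mult \<alpha>_unit \<alpha>_nonunit \<alpha>_mult split T_infinite T_Int T_value T_distinct T_divides)+
qed

lemma const_fun_nonunit:
  assumes "d \<in> D" "d \<noteq> 0" "d \<notin> Units (ring_on D)"
  shows "const_fun d \<in> I" "const_fun d \<noteq> 0" "1 \<le> mval d"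
proof -
  show "const_fun d \<in> I" using const_fun_Int assms by blast
  show "const_fun d \<noteq> 0" using assms const_fun_inject[of d 0] by simp
  show "1 \<le> mval d" using D_cases[OF assms(1)] assms by (auto simp: Units_ring_on_iff)
qed

end

theorem theorem5p2:
  fixes \<Gamma> M :: "real set"
    and D K :: "(real \<Rightarrow>\<^sub>0 'k::field) fract set"
  assumes subgroup: "additive_subgroup \<Gamma> (ring_of_type_algebra :: real ring)"
    and no_min: "\<not> (\<exists>\<gamma>\<in>\<Gamma>. 0 < \<gamma> \<and> (\<forall>\<delta>\<in>\<Gamma>. 0 < \<delta> \<longrightarrow> \<gamma> \<le> \<delta>))"
    and one: "1 \<in> \<Gamma>"
    and M: "M = {0} \<union> {\<gamma> \<in> \<Gamma>. \<gamma> \<ge> 1}"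
    and D: "D = localized_monoid_ring M"
    and K: "K = fraction_field_of D"
    and k_or_gp: "\<not> (\<forall>p :: 'k poly. Polynomial.degree p > 0 \<longrightarrow> (\<exists>x. poly p x = 0))
                  \<or> \<not> divisible_set (gp M)"
  shows "(\<forall>d\<in>D. d \<noteq> 0 \<and> d \<notin> Units (ring_on D) \<longrightarrow>
            1 \<le> mval d \<and>
            (mval d \<ge> 2 \<longrightarrow> length_set (ring_on (Int_R K D)) (const_fun d)
               = {2..nat \<lfloor>real_of_ereal (mval d)\<rfloor>}) \<and>
            (1 \<le> mval d \<and> mval d < 2 \<longrightarrow>
               length_set (ring_on (Int_R K D)) (const_fun d) = {1}) \<and>
            (1 \<le> mval d \<and> mval d < 2 \<longrightarrow>
               catenary_degree (ring_on (Int_R K D)) (const_fun d) = 0) \<and>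
            (2 \<le> mval d \<and> mval d < 3 \<longrightarrow>
               catenary_degree (ring_on (Int_R K D)) (const_fun d) = 2) \<and>
            (mval d \<ge> 3 \<longrightarrow>
               catenary_degree (ring_on (Int_R K D)) (const_fun d) = 3))
       \<and> (\<forall>\<phi>\<in>Int_R K D. \<phi> \<noteq> 0 \<and> \<phi> \<notin> Units (ring_on (Int_R K D)) \<longrightarrow>
            1 \<le> min_val K \<phi> \<and>
            (min_val K \<phi> \<ge> 2 \<longrightarrow> length_set (ring_on (Int_R K D)) \<phi>
               = {2..nat \<lfloor>real_of_ereal (min_val K \<phi>)\<rfloor>}) \<and>
            (1 \<le> min_val K \<phi> \<and> min_val K \<phi> < 2 \<longrightarrow>
               length_set (ring_on (Int_R K D)) \<phi> = {1}))"
proof -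
  interpret truncated_monoid_domain \<Gamma> M D K
    by (rule truncated_monoid_domain.intro) (fact subgroup no_min one M D K)+
  interpret valued_submonoid I \<alpha> T by (rule valued_submonoid_Int[OF k_or_gp])
  \<comment> \<open>Writing the extended real numerals as embedded reals turns all bounds on
    \<open>mval\<close> and \<open>min_val\<close> into bounds on \<open>\<alpha>\<close>.\<close>
  have num: "(1 :: ereal) = ereal 1" "(2 :: ereal) = ereal 2" "(3 :: ereal) = ereal 3"
    by (simp_all add: one_ereal_def numeral_eq_ereal)
  show ?thesis (is "(\<forall>d\<in>D. ?A d \<longrightarrow> ?P d) \<and> (\<forall>\<phi>\<in>I. ?B \<phi> \<longrightarrow> ?Q \<phi>)")
  proof (intro conjI[of "\<forall>d\<in>D. ?A d \<longrightarrow> ?P d"] ballI impI)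
    fix d assume d: "d \<in> D" "?A d"
    note c = const_fun_nonunit[OF d(1) d(2)[THEN conjunct1] d(2)[THEN conjunct2]]
    have v: "mval d = ereal (\<alpha> (const_fun d))" using \<alpha>_const d by blast
    show "?P d"
      using c(3) length_set_ge_2[OF c(1,2)] length_set_atom[OF c(1,2)] catenary_degree_atom[OF c(1,2)]
        catenary_degree_2[OF c(1,2)] catenary_degree_ge_3[OF c(1,2)]
      unfolding v num by simp
  next
    fix \<phi> assume \<phi>: "\<phi> \<in> I" "?B \<phi>"
    then have "1 \<le> \<alpha> \<phi>" using \<alpha>_nonunit by (auto simp: Units_ring_on_iff)
    then show "?Q \<phi>"
      using length_set_ge_2[of \<phi>] length_set_atom[of \<phi>] \<phi>
      unfolding min_val_eq[OF \<phi>(1) \<phi>(2)[THEN conjunct1]] num by simp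
  qed
qed

end
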